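(* For every $n\ge 1$ there exist $\delta(n)>0$ and a constant $C=C(n)>0$ such that the following holds. Let $S$ be a simplex in $\mathbb{R}^n$ (with nonempty interior) and let $K$ be a convex body in $\mathbb{R}^n$ with $d_{BM}(K,S)=1+\delta$ for some $0<\delta<\delta(n)$. Then $$\mathcal{P}(K)\ \ge\ \mathcal{P}(S)+C\delta .$$
   Context: A convex body in $\mathbb{R}^n$ is a compact convex set with nonempty interior; $|\cdot|$ of a set denotes its volume (Lebesgue measure) and $\langle\cdot,\cdot\rangle$ is the canonical scalar product. For a convex body $K$ and $z\in\mathrm{int}(K)$, the polar body of $K$ with center of polarity $z$ is $K^z=\{y\in\mathbb{R}^n:\langle y,x-z\rangle\le 1\text{ for all }x\in K\}$. The volume product of $K$ is $\mathcal{P}(K)=\inf\{|K|\,|K^z| : z\in\mathrm{int}(K)\}$. The (affine-invariant) Banach–Mazur distance between convex bodies $K,L\subset\mathbb{R}^n$ is $$d_{BM}(K,L)=\inf\{c : A(L)\subset B(K)\subset cA(L)\text{ for some affine isomorphisms }A,B\text{ of }\mathbb{R}^n\},$$ where $cA(L)=\{cx:x\in A(L)\}$. *)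

theory Defs
  imports "HOL-Analysis.Analysis"
begin

definition convex_body :: "'a::euclidean_space set \<Rightarrow> bool" where
  "convex_body K \<longleftrightarrow> compact K \<and> convex K \<and> interior K \<noteq> {}"

definition polar_body :: "'a::euclidean_space set \<Rightarrow> 'a \<Rightarrow> 'a set" where
  "polar_body K z = {y. \<forall>x\<in>K. y \<bullet> (x - z) \<le> 1}"

definition volume_product :: "'a::euclidean_space set \<Rightarrow> real" where
  "volume_product K = (INF z\<in>interior K. measure lebesgue K * measure lebesgue (polar_body K z))"

definition affine_isomorphism :: "('a::real_vector \<Rightarrow> 'a) \<Rightarrow> bool" where
  "affine_isomorphism A \<longleftrightarrow> (\<exists>f b. linear f \<and> bij f \<and> A = (\<lambda>x. f x + b))"

(* The ratio c ranges over positive reals: allowing negative c would make the set of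
   admissible c unbounded below, as T \<subseteq> c T for every c \<le> - n when T is an n-simplex
   with centroid 0. For convex bodies, positive admissible c automatically satisfy c \<ge> 1. *)
definition banach_mazur_distance :: "'a::euclidean_space set \<Rightarrow> 'a set \<Rightarrow> real" where
  "banach_mazur_distance K L =
     Inf {c. c > 0 \<and> (\<exists>A B. affine_isomorphism A \<and> affine_isomorphism B \<and>
                A ` L \<subseteq> B ` K \<and> B ` K \<subseteq> (\<lambda>x. c *\<^sub>R x) ` (A ` L))}"

end

theory Submission imports Defs begin

text \<open>
  Why the theorem is true. Let \<open>n\<close> be the dimension and \<open>N = n + 1\<close>. The volume product is affine
  invariant (\<open>volume_product_affine_image\<close>), so \<open>K\<close> may be moved until a simplex of maximal volume
  inscribed in \<open>K\<close> is the standard simplex \<open>T\<close> (\<open>normalized_position\<close>). Maximality says that all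
  barycentric coordinates are at most \<open>1\<close> on \<open>K\<close>. A distance \<open>1 + \<delta>\<close> from the simplex says two more
  things: the volume of \<open>K\<close> is at most \<open>(1 + 2 * \<delta>) ^ n\<close> times that of \<open>T\<close>, so the
  barycentric coordinates are at least \<open>- \<tau>\<close> with \<open>\<tau> = 4 * n * \<delta>\<close> (\<open>bary_ge_if_measure_le\<close>); and some coordinate
  takes a value below \<open>- \<delta> / (2 * N)\<close>, since otherwise \<open>K\<close> would lie in a small dilate of \<open>T\<close>
  (\<open>bm_ratio_if_bary_ge\<close>).

  The core is a first order expansion of both volumes, with errors \<open>\<epsilon> * \<delta>\<close> and \<open>\<delta>\<^sup>2\<close>, where
  \<open>\<epsilon>\<close> is a small constant that depends on \<open>n\<close> only. Suppose a convex set \<open>A\<close> is known to reach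
  certain distances in the directions of the facet centroids of a simplex and of points of each
  facet that lie \<open>\<epsilon>\<close>-close to its vertices. Then \<open>measure_ge_perturbed_simplex\<close> bounds its volume
  from below: on each facet, subdivided by its centroid, the gauge is linearly interpolated, and
  the rim of the facet, of relative size \<open>\<epsilon>\<close>, costs only \<open>\<epsilon> * \<delta>\<close>. This is applied to \<open>K\<close> and to \<open>polar_body K z\<close>.

  Call the facet opposite to the vertex \<open>j\<close> of \<open>T\<close> the facet \<open>j\<close>. Let \<open>S i j\<close> measure by how much \<open>K\<close> exceeds
  the facet \<open>j\<close> near the vertex \<open>i\<close>; precisely, it
  is the excess of the support function of \<open>K\<close> in the direction of \<open>vertex_functional \<epsilon> i j\<close>. The
  polar body loses \<open>S i j\<close> in its direction \<open>(i, j)\<close>. The point of \<open>K\<close> that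
  attains the support function shows that \<open>K\<close> itself gains \<open>S i j\<close> above facet \<open>j\<close> near vertex \<open>i\<close>.
  With equal weights on both sides these two effects cancel: up to constant factors and the errors above, the volumes are at least
  \<open>1 + Q + gain\<close> and \<open>1 - Q\<close> with the same \<open>Q\<close>. At the facet centroids the polar body loses
  nothing, by maximality of \<open>T\<close>, whereas \<open>K\<close> gains a multiple of \<open>\<delta>\<close> above the facet at which a
  coordinate is below \<open>- \<delta> / (2 * N)\<close>. This gain survives in the product. The bound for the
  polar body does not depend on the centre \<open>z\<close>, because \<open>z\<close> enters the interpolated support function
  linearly and the normals of \<open>T\<close> add up to zero; hence no Santalo point is needed.
\<close>

section \<open>Linear images of Lebesgue measure\<close>

text \<open>Both sides are multiplicative under composition, so elementary maps suffice; for swaps and shears it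
  is enough to look at boxes.\<close>
lemma measure_lebesgue_linear_image:
  fixes f :: "real^'n \<Rightarrow> real^'n"
  assumes "linear f" "S \<in> lmeasurable"
  shows "f ` S \<in> lmeasurable \<and> measure lebesgue (f ` S) = \<bar>det (matrix f)\<bar> * measure lebesgue S"
proof -
  define P where "P f \<longleftrightarrow> (\<forall>S\<in>lmeasurable. f ` S \<in> lmeasurable \<and>
      measure lebesgue (f ` S) = \<bar>det (matrix f)\<bar> * measure lebesgue S)" for f :: "real^'n \<Rightarrow> real^'n"
  have boxes: "P h" if h: "linear h" and det: "\<bar>det (matrix h)\<bar> = 1"
    and box: "\<And>a b. measure lebesgue (h ` cbox a b) = measure lebesgue (cbox a b)" for h
    unfolding P_def
  proof (intro ballI)
    fix S :: "(real^'n) set" assume "S \<in> lmeasurable"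
    then show "h ` S \<in> lmeasurable \<and> measure lebesgue (h ` S) = \<bar>det (matrix h)\<bar> * measure lebesgue S"
      using measure_linear_sufficient[OF h, of S 1] box det by simp
  qed
  have "P f"
    using \<open>linear f\<close>
  proof (rule induct_linear_elementary)
    fix f g :: "real^'n \<Rightarrow> real^'n"
    assume "linear f" "linear g" "P f" "P g"
    then show "P (f \<circ> g)"
      unfolding P_def image_comp[symmetric]
      by (simp add: matrix_compose det_mul abs_mult)
  next
    fix f :: "real^'n \<Rightarrow> real^'n" and i
    assume f: "linear f" and 0: "\<And>x. f x $ i = 0"
    have ninj: "\<not> inj f"
      using linear_injective_imp_surjective[OF f] 0 
      by (metis one_neq_zero surjE vec_component)
    then have "det (matrix f) = 0"
      using det_nz_iff_inj[OF f] by blast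
    moreover have "negligible (f ` S)" for S
      using negligible_linear_singular_image[OF f ninj] by blast
    ultimately show "P f"
      unfolding P_def by (simp add: negligible_iff_measure)
  next
    fix c
    have "det (matrix (\<lambda>x::real^'n. \<chi> i. c i * x $ i)) = prod c UNIV"
      by (simp add: axis_def matrix_def det_diagonal)
    then show "P (\<lambda>x::real^'n. \<chi> i. c i * x $ i)"
      unfolding P_def by (simp add: measurable_stretch measure_stretch)
  next
    fix m n :: 'n
    assume "m \<noteq> n"
    let ?t = "Transposition.transpose m n"
    let ?h = "\<lambda>x::real^'n. \<chi> i. x $ ?t i"
    show "P ?h"
    proof (rule boxes)
      show "linear ?h"
        by (rule linearI) (simp_all add: vec_eq_iff)
      have "matrix ?h = (\<chi> i. (mat 1 :: real^'n^'n) $ ?t i)"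
        by (simp add: matrix_def mat_def axis_def vec_eq_iff)
      then show "\<bar>det (matrix ?h)\<bar> = 1"
        using det_permute_rows[OF permutes_swap_id[of m UNIV n], of "mat 1 :: real^'n^'n"]
        by (simp add: abs_mult sign_def)
      show "measure lebesgue (?h ` cbox a b) = measure lebesgue (cbox a b)" for a b
      proof -
        have inv: "?h (?h x) = x" for x by (simp add: vec_eq_iff)
        have "?h ` cbox a b = cbox (?h a) (?h b)"
        proof (rule set_eqI)
          fix x
          have all: "(\<forall>i. Q (?t i)) \<longleftrightarrow> (\<forall>i. Q i)" for Q by (metis transpose_involutory)
          have "x \<in> ?h ` cbox a b \<longleftrightarrow> ?h x \<in> cbox a b"
          proof
            assume "x \<in> ?h ` cbox a b"
            then obtain y where "y \<in> cbox a b" "x = ?h y" by blast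
            then show "?h x \<in> cbox a b" by (simp only: inv)
          next
            assume "?h x \<in> cbox a b"
            then have "?h (?h x) \<in> ?h ` cbox a b" by (rule imageI)
            then show "x \<in> ?h ` cbox a b" by (simp only: inv)
          qed
          then show "x \<in> ?h ` cbox a b \<longleftrightarrow> x \<in> cbox (?h a) (?h b)"
            using all[of "\<lambda>i. a $ i \<le> x $ ?t i \<and> x $ ?t i \<le> b $ i"] by (simp add: mem_box_cart)
        qed
        moreover have "cbox (?h a) (?h b) = {} \<longleftrightarrow> cbox a b = {}"
          using calculation by (metis image_is_empty)
        moreover have "(\<Prod>i\<in>UNIV. b $ ?t i - a $ ?t i) = (\<Prod>i\<in>UNIV. b $ i - a $ i)"
          using prod.permute[OF permutes_swap_id[of m UNIV n], of "\<lambda>i. b $ i - a $ i"] by (simp add: o_def)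
        ultimately show ?thesis
          by (cases "cbox a b = {}") (simp_all add: content_cbox_cart)
      qed
    qed
  next
    fix m n :: 'n
    assume mn: "m \<noteq> n"
    let ?h = "\<lambda>x::real^'n. \<chi> i. if i = m then x $ m + x $ n else x $ i"
    show "P ?h"
    proof (rule boxes)
      show lin: "linear ?h"
        by (rule linearI) (auto simp: vec_eq_iff algebra_simps)
      have "matrix ?h = (\<chi> k. if k = m then row m (mat 1) + 1 *s row n (mat 1) else row k (mat 1 :: real^'n^'n))"
        using mn by (auto simp: matrix_def mat_def axis_def row_def vec_eq_iff)
      then show "\<bar>det (matrix ?h)\<bar> = 1"
        using det_row_operation[OF mn, of "mat 1 :: real^'n^'n" 1] by simp
      show "measure lebesgue (?h ` cbox a b) = measure lebesgue (cbox a b)" for a b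
      proof (cases "cbox a b = {}")
        case False
        \<comment> \<open>translate the box to make its coordinate \<open>n\<close> nonnegative, as \<open>measure_shear_interval\<close> requires\<close>
        define v where "v = (\<chi> i. - a $ i)"
        have ne: "cbox (v + a) (v + b) \<noteq> {}"
          using False by (metis cbox_translation image_is_empty)
        have "?h ` cbox (v + a) (v + b) = (+) (?h v) ` ?h ` cbox a b"
          unfolding cbox_translation image_image
          by (rule image_cong[OF refl]) (rule linear_add[OF lin])
        then have "measure lebesgue (?h ` cbox a b) = measure lebesgue (?h ` cbox (v + a) (v + b))"
          by (simp only: measure_translation)
        also have "\<dots> = measure lebesgue (cbox (v + a) (v + b))"
          by (rule measure_shear_interval[OF mn ne]) (simp add: v_def)
        also have "\<dots> = measure lebesgue ((+) v ` cbox a b)"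
          by (simp only: cbox_translation)
        also have "\<dots> = measure lebesgue (cbox a b)"
          by (rule measure_translation)
        finally show ?thesis .
      qed simp
    qed
  qed
  with assms show ?thesis by (simp add: P_def)
qed

section \<open>Barycentric coordinates and volumes of simplices\<close>

lemma sum_UNIV_option: "(\<Sum>k\<in>UNIV. f k) = f None + (\<Sum>i\<in>UNIV. f (Some i))"
  for f :: "'n::finite option \<Rightarrow> 'a::comm_monoid_add"
  by (simp add: UNIV_option_conv sum.reindex)

text \<open>The \<open>n + 1\<close> vertices of a simplex in \<open>real^'n\<close> are indexed by \<open>'n option\<close>. The vertex \<open>None\<close> is the origin.\<close>
definition std_vertex :: "'n::finite option \<Rightarrow> real^'n" where
  "std_vertex k = (case k of None \<Rightarrow> 0 | Some i \<Rightarrow> axis i 1)"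

definition bary :: "'n::finite option \<Rightarrow> real^'n \<Rightarrow> real" where
  "bary k x = (case k of None \<Rightarrow> 1 - (\<Sum>i\<in>UNIV. x $ i) | Some i \<Rightarrow> x $ i)"

text \<open>Minus the gradient of the barycentric coordinate \<open>bary k\<close>, that is, the outer normal of the facet
  opposite to the vertex \<open>k\<close>, scaled so that these normals add up to zero.\<close>
definition facet_normal :: "'n::finite option \<Rightarrow> real^'n" where
  "facet_normal k = (case k of None \<Rightarrow> (\<chi> i. 1) | Some i \<Rightarrow> - axis i 1)"

definition simplex_map :: "('n::finite option \<Rightarrow> real^'n) \<Rightarrow> real^'n \<Rightarrow> real^'n" where
  "simplex_map P x = (\<Sum>k\<in>UNIV. bary k x *\<^sub>R P k)"

definition hull_volume :: "('n::finite option \<Rightarrow> real^'n) \<Rightarrow> real" where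
  "hull_volume P = measure lebesgue (convex hull (range P))"

lemma sum_bary [simp]: "(\<Sum>k\<in>UNIV. bary k x) = 1"
  by (simp add: sum_UNIV_option bary_def)

lemma simplex_map_std_vertex: "simplex_map std_vertex x = x"
  by (simp add: simplex_map_def sum_UNIV_option bary_def std_vertex_def vec_eq_iff axis_def
      if_distrib[of "\<lambda>y. _ * y"] cong: if_cong)

lemma bary_std_vertex: "bary k (std_vertex j) = of_bool (k = j)"
  by (cases k; cases j) (auto simp: bary_def std_vertex_def axis_def)

lemma bary_affine:
  assumes "(\<Sum>j\<in>A. \<mu> j) = 1"
  shows "bary k (\<Sum>j\<in>A. \<mu> j *\<^sub>R p j) = (\<Sum>j\<in>A. \<mu> j * bary k (p j))"
proof (cases k)
  case None
  have "(\<Sum>i\<in>UNIV. \<Sum>j\<in>A. \<mu> j * p j $ i) = (\<Sum>j\<in>A. \<mu> j * (\<Sum>i\<in>UNIV. p j $ i))"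
    by (subst sum.swap) (simp add: sum_distrib_left)
  then show ?thesis
    using None assms by (simp add: bary_def right_diff_distrib sum_subtractf)
qed (simp add: bary_def)

lemma bary_combine:
  assumes "s + t = 1"
  shows "bary k (s *\<^sub>R x + t *\<^sub>R y) = s * bary k x + t * bary k y"
proof -
  have "1 - (s * a + t * b) = s * (1 - a) + t * (1 - b)" for a b
    using assms by (simp add: algebra_simps)
  then show ?thesis
    by (cases k) (simp_all add: bary_def sum.distrib sum_distrib_left[symmetric])
qed

lemma facet_normal_inner: "facet_normal k \<bullet> (x - z) = bary k z - bary k x"
  by (cases k) (simp_all add: facet_normal_def bary_def inner_vec_def sum_subtractf axis_def
      if_distrib[of "\<lambda>y. y * _"] if_distrib[of uminus] cong: if_cong)

lemma simplex_map_comb: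
  assumes "(\<Sum>k\<in>UNIV. t k) = 1"
  shows "simplex_map P (\<Sum>k\<in>UNIV. t k *\<^sub>R std_vertex k) = (\<Sum>k\<in>UNIV. t k *\<^sub>R P k)"
proof -
  have "bary k (\<Sum>j\<in>UNIV. t j *\<^sub>R std_vertex j) = t k" for k
    by (simp add: bary_affine[OF assms] bary_std_vertex if_distrib[of "\<lambda>y. _ * y"] of_bool_def cong: if_cong)
  then show ?thesis by (simp add: simplex_map_def)
qed

lemma simplex_map_linear:
  fixes P :: "'n::finite option \<Rightarrow> real^'n"
  defines "L \<equiv> \<lambda>x. \<Sum>i\<in>UNIV. x $ i *\<^sub>R (P (Some i) - P None)"
  shows "linear L" "simplex_map P x = P None + L x"
    "det (matrix L) = det (\<chi> i. P (Some i) - P None)"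
proof -
  show "linear L"
    unfolding L_def by (rule linearI) (simp_all add: scaleR_add_left sum.distrib scaleR_sum_right)
  show "simplex_map P x = P None + L x"
    by (simp add: simplex_map_def sum_UNIV_option bary_def L_def scaleR_left_diff_distrib scaleR_diff_right
        sum_subtractf scaleR_sum_left)
  have "L (axis j 1) = P (Some j) - P None" for j
    by (simp add: L_def axis_def if_distrib[of "\<lambda>y. y *\<^sub>R _"] cong: if_cong)
  then have "matrix L = transpose (\<chi> i. P (Some i) - P None)"
    by (simp add: matrix_def transpose_def vec_eq_iff)
  then show "det (matrix L) = det (\<chi> i. P (Some i) - P None)"
    by simp
qed

lemma convex_hull_range:
  fixes P :: "'n::finite option \<Rightarrow> 'b::real_vector"
  shows "convex hull (range P) = {\<Sum>k\<in>UNIV. t k *\<^sub>R P k | t. (\<forall>k. 0 \<le> t k) \<and> (\<Sum>k\<in>UNIV. t k) = 1}"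
    (is "_ = ?C")
proof
  show "convex hull (range P) \<subseteq> ?C"
  proof (rule hull_minimal)
    show "range P \<subseteq> ?C"
    proof clarify
      fix k
      show "\<exists>t. P k = (\<Sum>j\<in>UNIV. t j *\<^sub>R P j) \<and> (\<forall>j. 0 \<le> t j) \<and> (\<Sum>j\<in>UNIV. t j) = (1::real)"
        by (rule exI[of _ "\<lambda>j. if j = k then 1 else 0"])
          (simp add: if_distrib[of "\<lambda>y. y *\<^sub>R _"] cong: if_cong)
    qed
    show "convex ?C"
    proof (rule convexI)
      fix x y and u v :: real
      assume uv: "0 \<le> u" "0 \<le> v" "u + v = 1" and "x \<in> ?C" "y \<in> ?C"
      then obtain s t where s: "\<forall>k. 0 \<le> s k" "(\<Sum>k\<in>UNIV. s k) = 1" "x = (\<Sum>k\<in>UNIV. s k *\<^sub>R P k)"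
        and t: "\<forall>k. 0 \<le> t k" "(\<Sum>k\<in>UNIV. t k) = 1" "y = (\<Sum>k\<in>UNIV. t k *\<^sub>R P k)"
        by blast
      have "u *\<^sub>R x + v *\<^sub>R y = (\<Sum>k\<in>UNIV. (u * s k + v * t k) *\<^sub>R P k)"
        by (simp add: s t scaleR_sum_right scaleR_add_left sum.distrib)
      moreover have "(\<Sum>k\<in>UNIV. u * s k + v * t k) = 1"
        using uv s t by (simp add: sum.distrib sum_distrib_left[symmetric])
      ultimately show "u *\<^sub>R x + v *\<^sub>R y \<in> ?C"
        using uv s t by (auto intro!: exI[of _ "\<lambda>k. u * s k + v * t k"])
    qed
  qed
  show "?C \<subseteq> convex hull (range P)"
  proof clarify
    fix t :: "'n option \<Rightarrow> real"
    assume "\<forall>k. 0 \<le> t k" "(\<Sum>k\<in>UNIV. t k) = 1"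
    then show "(\<Sum>k\<in>UNIV. t k *\<^sub>R P k) \<in> convex hull (range P)"
      by (intro convex_sum) (auto intro: hull_inc)
  qed
qed

lemma std_simplex_eq: "convex hull (range std_vertex) = {x. \<forall>k. 0 \<le> bary k x}"
proof (intro subset_antisym subsetI CollectI allI)
  fix x :: "real^'n" and k assume "x \<in> convex hull (range std_vertex)"
  then obtain t where t: "\<forall>k. 0 \<le> t k" "(\<Sum>k\<in>UNIV. t k) = 1" "x = (\<Sum>k\<in>UNIV. t k *\<^sub>R std_vertex k)"
    unfolding convex_hull_range by blast
  then show "0 \<le> bary k x"
    by (simp add: bary_affine bary_std_vertex sum_nonneg)
next
  fix x :: "real^'n" assume "x \<in> {x. \<forall>k. 0 \<le> bary k x}"
  then show "x \<in> convex hull (range std_vertex)"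
    unfolding convex_hull_range
    using simplex_map_std_vertex[of x, symmetric] by (auto simp: simplex_map_def intro!: exI[of _ "\<lambda>k. bary k x"])
qed

lemma simplex_map_image: "simplex_map P ` (convex hull (range std_vertex)) = convex hull (range P)"
proof (intro subset_antisym subsetI)
  fix y assume "y \<in> simplex_map P ` (convex hull (range std_vertex))"
  then obtain x where "\<forall>k. 0 \<le> bary k x" "y = (\<Sum>k\<in>UNIV. bary k x *\<^sub>R P k)"
    unfolding std_simplex_eq simplex_map_def by blast
  then show "y \<in> convex hull (range P)"
    unfolding convex_hull_range[of P] by (intro CollectI exI[of _ "\<lambda>k. bary k x"]) simp
next
  fix y assume "y \<in> convex hull (range P)"
  then obtain t where t: "\<forall>k. 0 \<le> t k" "(\<Sum>k\<in>UNIV. t k) = 1" "y = (\<Sum>k\<in>UNIV. t k *\<^sub>R P k)"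
    unfolding convex_hull_range by blast
  show "y \<in> simplex_map P ` (convex hull (range std_vertex))"
  proof (rule image_eqI)
    show "y = simplex_map P (\<Sum>k\<in>UNIV. t k *\<^sub>R std_vertex k)"
      using t by (simp add: simplex_map_comb)
    show "(\<Sum>k\<in>UNIV. t k *\<^sub>R std_vertex k) \<in> convex hull (range std_vertex)"
      using t unfolding convex_hull_range by blast
  qed
qed

lemma compact_hull_range [simp]: "compact (convex hull (range P))"
  for P :: "'n::finite option \<Rightarrow> 'b::euclidean_space"
  by (simp add: finite_imp_compact_convex_hull)

lemma lmeasurable_hull_range [simp]: "convex hull (range P) \<in> lmeasurable"
  for P :: "'n::finite option \<Rightarrow> 'b::euclidean_space"
  by (simp add: lmeasurable_compact)

lemma hull_volume_std_vertex: "hull_volume (std_vertex :: 'n option \<Rightarrow> real^'n) = 1 / fact CARD('n::finite)"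
proof -
  have "range std_vertex = insert 0 (Basis :: (real^'n) set)"
    unfolding std_vertex_def Basis_vec_def UNIV_option_conv image_insert image_image by auto
  then have "hull_volume (std_vertex :: 'n option \<Rightarrow> real^'n) = measure lebesgue (convex hull (insert 0 (Basis :: (real^'n) set)))"
    by (simp add: hull_volume_def)
  also have "\<dots> = measure lborel (convex hull (insert 0 (Basis :: (real^'n) set)))"
    by (intro measure_completion)
      (simp add: borel_compact finite_imp_compact_convex_hull)
  finally show ?thesis by (simp add: content_std_simplex)
qed

lemma hull_volume_det:
  "hull_volume P = \<bar>det (\<chi> i. P (Some i) - P None)\<bar> / fact CARD('n)"
  for P :: "'n::finite option \<Rightarrow> real^'n"
proof -
  define L where "L \<equiv> \<lambda>x::real^'n. \<Sum>i\<in>UNIV. x $ i *\<^sub>R (P (Some i) - P None)"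
  note L = simplex_map_linear[of P, folded L_def]
  let ?T = "convex hull (range std_vertex) :: (real^'n) set"
  have "convex hull (range P) = (+) (P None) ` L ` ?T"
    unfolding simplex_map_image[of P, symmetric] image_image L(2) L_def ..
  then have "hull_volume P = measure lebesgue (L ` ?T)"
    by (simp add: hull_volume_def measure_translation)
  also have "\<dots> = \<bar>det (matrix L)\<bar> * hull_volume (std_vertex :: 'n option \<Rightarrow> _)"
    using measure_lebesgue_linear_image[OF L(1), of ?T] by (simp add: hull_volume_def)
  finally show ?thesis by (simp add: L(3) hull_volume_std_vertex)
qed

lemma hull_volume_replace_Some:
  fixes P :: "'n::finite option \<Rightarrow> real^'n"
  assumes \<mu>: "(\<Sum>j\<in>UNIV. \<mu> j) = 1"
  shows "hull_volume (P(Some m := \<Sum>j\<in>UNIV. \<mu> j *\<^sub>R P j)) = \<bar>\<mu> (Some m)\<bar> * hull_volume P"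
proof -
  let ?A = "\<chi> i. P (Some i) - P None"
  let ?x = "\<chi> i. \<mu> (Some i)"
  have None: "\<mu> None = 1 - (\<Sum>i\<in>UNIV. \<mu> (Some i))"
    using \<mu> by (simp add: sum_UNIV_option)
  have "(\<Sum>j\<in>UNIV. \<mu> j *\<^sub>R P j) - P None = (\<Sum>i\<in>UNIV. \<mu> (Some i) *\<^sub>R (P (Some i) - P None))"
    by (simp add: sum_UNIV_option None scaleR_left_diff_distrib scaleR_diff_right sum_subtractf scaleR_sum_left)
  also have "\<dots> = (\<Sum>i\<in>UNIV. ?x $ i *s row i ?A)"
    by (simp add: row_def vec_eq_iff)
  finally have "(\<chi> i. (P(Some m := \<Sum>j\<in>UNIV. \<mu> j *\<^sub>R P j)) (Some i) - (P(Some m := \<Sum>j\<in>UNIV. \<mu> j *\<^sub>R P j)) None)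
      = (\<chi> i. if i = m then \<Sum>i\<in>UNIV. ?x $ i *s row i ?A else row i ?A)"
    by (simp add: vec_eq_iff row_def)
  then show ?thesis
    unfolding hull_volume_det using cramer_lemma_transpose[of m ?x ?A] by (simp add: abs_mult)
qed

text \<open>The basic volume computation: moving one vertex to a point with given barycentric coordinates. For
  the vertex \<open>None\<close> the formula follows from the other vertices, because the convex hull does not
  see a permutation of the vertices.\<close>
lemma hull_volume_replace:
  fixes P :: "'n::finite option \<Rightarrow> real^'n"
  assumes \<mu>: "(\<Sum>j\<in>UNIV. \<mu> j) = 1" and p: "p = (\<Sum>j\<in>UNIV. \<mu> j *\<^sub>R P j)"
  shows "hull_volume (P(k := p)) = \<bar>\<mu> k\<bar> * hull_volume P"
proof (cases k)
  case (Some m)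
  then show ?thesis using hull_volume_replace_Some[OF \<mu>, of P m] p by simp
next
  case None
  obtain m :: 'n where True by blast
  let ?\<tau> = "Transposition.transpose None (Some m)"
  have \<tau>: "bij ?\<tau>" by simp
  have "range ((P(k := p)) \<circ> ?\<tau>) = range (P(k := p))" "range (P \<circ> ?\<tau>) = range P"
    unfolding image_comp[symmetric] using bij_is_surj[OF \<tau>] by simp_all
  then have eq: "hull_volume (P(k := p)) = hull_volume ((P(k := p)) \<circ> ?\<tau>)" "hull_volume (P \<circ> ?\<tau>) = hull_volume P"
    by (simp_all add: hull_volume_def)
  have "(P(k := p)) \<circ> ?\<tau> = (P \<circ> ?\<tau>)(Some m := p)"
    using None by (auto simp: fun_eq_iff Transposition.transpose_def)
  moreover have "p = (\<Sum>j\<in>UNIV. (\<mu> \<circ> ?\<tau>) j *\<^sub>R (P \<circ> ?\<tau>) j)"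
    using sum.reindex_bij_betw[OF \<tau>, of "\<lambda>j. \<mu> j *\<^sub>R P j"] p by simp
  moreover have "(\<Sum>j\<in>UNIV. (\<mu> \<circ> ?\<tau>) j) = 1"
    using sum.reindex_bij_betw[OF \<tau>, of \<mu>] \<mu> by simp
  ultimately show ?thesis
    using hull_volume_replace_Some[of "\<mu> \<circ> ?\<tau>" "P \<circ> ?\<tau>" m] None eq by simp
qed

section \<open>Convex sets inside simplicial cones\<close>

definition pos_cone :: "('k::finite \<Rightarrow> 'a::real_vector) \<Rightarrow> 'a set" where
  "pos_cone P = {\<Sum>k\<in>UNIV. t k *\<^sub>R P k | t. \<forall>k. 0 \<le> t k}"

lemma pos_cone_generator: "P k \<in> pos_cone P"
  unfolding pos_cone_def
  by (rule CollectI, rule exI[of _ "\<lambda>j. if j = k then 1 else 0"])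
    (simp add: if_distrib[of "\<lambda>y. y *\<^sub>R _"] cong: if_cong)

lemma pos_cone_comb:
  assumes "x \<in> pos_cone P" "y \<in> pos_cone P" "0 \<le> a" "0 \<le> b"
  shows "a *\<^sub>R x + b *\<^sub>R y \<in> pos_cone P"
proof -
  obtain s t where "\<forall>k. 0 \<le> s k" "x = (\<Sum>k\<in>UNIV. s k *\<^sub>R P k)" "\<forall>k. 0 \<le> t k" "y = (\<Sum>k\<in>UNIV. t k *\<^sub>R P k)"
    using assms(1,2) unfolding pos_cone_def by blast
  then show ?thesis
    using assms(3,4) unfolding pos_cone_def
    by (intro CollectI exI[of _ "\<lambda>k. a * s k + b * t k"])
      (simp add: scaleR_sum_right scaleR_add_left sum.distrib)
qed

lemma zero_in_pos_cone: "0 \<in> pos_cone P"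
  using pos_cone_comb[OF pos_cone_generator pos_cone_generator, of 0 0 P] by simp

lemma convex_pos_cone: "convex (pos_cone P)"
  by (rule convexI) (rule pos_cone_comb)

lemma pos_cone_sum:
  assumes "finite F" "\<And>j. j \<in> F \<Longrightarrow> f j \<in> pos_cone P" "\<And>j. j \<in> F \<Longrightarrow> 0 \<le> t j"
  shows "(\<Sum>j\<in>F. t j *\<^sub>R f j) \<in> pos_cone P"
  using assms
proof (induction F)
  case (insert m F)
  then show ?case
    using pos_cone_comb[of "f m" P "\<Sum>j\<in>F. t j *\<^sub>R f j" "t m" 1] by simp
qed (simp add: zero_in_pos_cone)

lemma pos_cone_mono:
  assumes "\<And>k. P k \<in> pos_cone Q"
  shows "pos_cone P \<subseteq> pos_cone Q"
proof
  fix x assume "x \<in> pos_cone P"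
  then obtain t where "\<forall>k. 0 \<le> t k" "x = (\<Sum>k\<in>UNIV. t k *\<^sub>R P k)"
    unfolding pos_cone_def by blast
  then show "x \<in> pos_cone Q"
    using pos_cone_sum[of UNIV P Q t] assms by simp
qed

lemma negligible_Int_pos_cones:
  fixes P Q :: "'k::finite \<Rightarrow> 'a::euclidean_space"
  assumes "a \<noteq> 0" "\<And>k. 0 \<le> a \<bullet> P k" "\<And>k. a \<bullet> Q k \<le> 0"
  shows "negligible (pos_cone P \<inter> pos_cone Q)"
proof (rule negligible_subset)
  show "negligible {x. a \<bullet> x = 0}"
    using assms(1) by (intro negligible_hyperplane) simp
  show "pos_cone P \<inter> pos_cone Q \<subseteq> {x. a \<bullet> x = 0}"
  proof clarify
    fix x assume "x \<in> pos_cone P" "x \<in> pos_cone Q"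
    then obtain s t where s: "\<forall>k. 0 \<le> s k" "x = (\<Sum>k\<in>UNIV. s k *\<^sub>R P k)"
      and t: "\<forall>k. 0 \<le> t k" "x = (\<Sum>k\<in>UNIV. t k *\<^sub>R Q k)"
      unfolding pos_cone_def by blast
    have "0 \<le> a \<bullet> x"
      unfolding s(2) inner_sum_right inner_scaleR_right
      using s(1) assms(2) by (intro sum_nonneg mult_nonneg_nonneg) auto
    moreover have "a \<bullet> x \<le> 0"
      unfolding t(2) inner_sum_right inner_scaleR_right
      using t(1) assms(3) by (intro sum_nonpos mult_nonneg_nonpos) auto
    ultimately show "a \<bullet> x = 0" by simp
  qed
qed

lemma lmeasurable_Int_pos_cone:
  fixes A :: "'a::euclidean_space set"
  assumes "convex A" "bounded A"
  shows "A \<inter> pos_cone P \<in> lmeasurable"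
  using assms by (intro measurable_convex convex_Int convex_pos_cone bounded_Int) auto

text \<open>The cones overlap in null sets only, and measurability comes from convexity and boundedness.\<close>
lemma sum_measure_cones_le:
  fixes P :: "'i \<Rightarrow> 'k::finite \<Rightarrow> 'a::euclidean_space"
  assumes A: "convex A" "bounded A" and "finite I"
    and disj: "\<And>i j. i \<in> I \<Longrightarrow> j \<in> I \<Longrightarrow> i \<noteq> j \<Longrightarrow> negligible (pos_cone (P i) \<inter> pos_cone (P j))"
    and sub: "\<And>i. i \<in> I \<Longrightarrow> pos_cone (P i) \<subseteq> C" and C: "A \<inter> C \<in> lmeasurable"
  shows "(\<Sum>i\<in>I. measure lebesgue (A \<inter> pos_cone (P i))) \<le> measure lebesgue (A \<inter> C)"
proof -
  have "pairwise (\<lambda>i j. negligible ((A \<inter> pos_cone (P i)) \<inter> (A \<inter> pos_cone (P j)))) I"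
    unfolding pairwise_def using disj by (meson IntD2 IntI negligible_subset subsetI IntE)
  then have "(\<Sum>i\<in>I. measure lebesgue (A \<inter> pos_cone (P i))) = measure lebesgue (\<Union>i\<in>I. A \<inter> pos_cone (P i))"
    using \<open>finite I\<close> lmeasurable_Int_pos_cone[OF A]
    by (intro measure_negligible_finite_Union_image[symmetric]) auto
  also have "\<dots> \<le> measure lebesgue (A \<inter> C)"
  proof (rule measure_mono_fmeasurable[OF _ _ C])
    show "(\<Union>i\<in>I. A \<inter> pos_cone (P i)) \<subseteq> A \<inter> C" using sub by blast
    show "(\<Union>i\<in>I. A \<inter> pos_cone (P i)) \<in> sets lebesgue"
      using \<open>finite I\<close> lmeasurable_Int_pos_cone[OF A] by (intro sets.finite_UN) auto
  qed
  finally show ?thesis .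
qed

lemma hull_volume_scale:
  fixes P :: "'n::finite option \<Rightarrow> real^'n"
  assumes "P i = 0" "i \<notin> J" "finite J"
  shows "hull_volume (\<lambda>k. if k \<in> J then s k *\<^sub>R P k else P k) = (\<Prod>k\<in>J. \<bar>s k\<bar>) * hull_volume P"
  using assms(3,2)
proof (induction J)
  case (insert m J)
  let ?Q = "\<lambda>k. if k \<in> J then s k *\<^sub>R P k else P k"
  let ?\<mu> = "\<lambda>j. if j = m then s m else if j = i then 1 - s m else 0"
  have im: "i \<noteq> m" using insert by blast
  have "(\<lambda>k. if k \<in> insert m J then s k *\<^sub>R P k else P k) = ?Q(m := s m *\<^sub>R P m)"
    using insert by (auto simp: fun_eq_iff)
  moreover have "(\<Sum>j\<in>UNIV. ?\<mu> j) = (\<Sum>j\<in>{m, i}. ?\<mu> j)"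
    by (rule sum.mono_neutral_right) auto
  then have "(\<Sum>j\<in>UNIV. ?\<mu> j) = 1"
    using im by simp
  moreover have "(\<Sum>j\<in>UNIV. ?\<mu> j *\<^sub>R ?Q j) = (\<Sum>j\<in>{m, i}. ?\<mu> j *\<^sub>R ?Q j)"
    by (rule sum.mono_neutral_right) auto
  then have "s m *\<^sub>R P m = (\<Sum>j\<in>UNIV. ?\<mu> j *\<^sub>R ?Q j)"
    using im insert assms(1) by simp
  ultimately show ?case
    using hull_volume_replace[of ?\<mu> "s m *\<^sub>R P m" ?Q m] insert by simp
qed simp

lemma hull_volume_nonneg [simp]: "0 \<le> hull_volume P"
  by (simp add: hull_volume_def)

lemma prod_inverse_ge:
  fixes h :: "'k \<Rightarrow> real"
  assumes "finite J" "\<And>k. k \<in> J \<Longrightarrow> 0 < h k"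
  shows "1 + (\<Sum>k\<in>J. 1 - h k) \<le> (\<Prod>k\<in>J. 1 / h k)"
proof -
  have "1 + (\<Sum>k\<in>J. 1 - h k) \<le> exp (\<Sum>k\<in>J. 1 - h k)"
    by (rule exp_ge_add_one_self)
  also have "\<dots> = (\<Prod>k\<in>J. exp (1 - h k))"
    using assms(1) by (rule exp_sum)
  also have "\<dots> \<le> (\<Prod>k\<in>J. 1 / h k)"
  proof (rule prod_mono)
    fix k assume k: "k \<in> J"
    have "h k \<le> exp (h k - 1)"
      using exp_ge_add_one_self[of "h k - 1"] by simp
    then have "exp (1 - h k) * h k \<le> exp (1 - h k) * exp (h k - 1)"
      by (intro mult_left_mono) auto
    then show "0 \<le> exp (1 - h k) \<and> exp (1 - h k) \<le> 1 / h k"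
      using assms(2)[OF k] by (simp add: exp_add[symmetric] field_simps)
  qed
  finally show ?thesis .
qed

text \<open>If the generators of a simplicial cone, divided by \<open>h k\<close>, lie in \<open>A\<close>, then so does the simplex that they span
  with the origin, and its volume is that of the original simplex divided by the product of the \<open>h k\<close>. A bound linear
  in \<open>h\<close> is weaker, but it can be added up over many cones.\<close>
lemma measure_cone_ge:
  fixes P :: "'n::finite option \<Rightarrow> real^'n"
  assumes A: "convex A" "bounded A" "0 \<in> A" and P: "P i = 0"
    and h: "\<And>k. k \<noteq> i \<Longrightarrow> 0 < h k" "\<And>k. k \<noteq> i \<Longrightarrow> (1 / h k) *\<^sub>R P k \<in> A"
  shows "hull_volume P * (1 + (\<Sum>k\<in>UNIV - {i}. 1 - h k)) \<le> measure lebesgue (A \<inter> pos_cone P)"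
proof -
  let ?Q = "\<lambda>k. if k \<in> UNIV - {i} then (1 / h k) *\<^sub>R P k else P k"
  have "hull_volume P * (1 + (\<Sum>k\<in>UNIV - {i}. 1 - h k)) \<le> hull_volume P * (\<Prod>k\<in>UNIV - {i}. 1 / h k)"
    using h(1) by (intro mult_left_mono prod_inverse_ge) auto
  also have "\<dots> = hull_volume P * (\<Prod>k\<in>UNIV - {i}. \<bar>1 / h k\<bar>)"
    using h(1) by (intro arg_cong[of _ _ "\<lambda>x. hull_volume P * x"] prod.cong) (simp_all add: less_imp_le)
  also have "\<dots> = hull_volume ?Q"
    using hull_volume_scale[of P i, OF P, of "UNIV - {i}" "\<lambda>k. 1 / h k"] by simp
  also have "\<dots> \<le> measure lebesgue (A \<inter> pos_cone P)"
    unfolding hull_volume_def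
  proof (rule measure_mono_fmeasurable[OF _ _ lmeasurable_Int_pos_cone[OF A(1,2)]])
    show "convex hull range ?Q \<in> sets lebesgue"
      using lmeasurable_hull_range[of ?Q] by blast
    show "convex hull range ?Q \<subseteq> A \<inter> pos_cone P"
    proof (rule hull_minimal)
      show "convex (A \<inter> pos_cone P)"
        by (intro convex_Int A convex_pos_cone)
      have "?Q k \<in> A \<inter> pos_cone P" for k
      proof (cases "k = i")
        case False
        then show ?thesis
          using h[of k] pos_cone_comb[OF pos_cone_generator[of P k] zero_in_pos_cone, of "1 / h k" 0] by simp
      qed (use P A zero_in_pos_cone in simp)
      then show "range ?Q \<subseteq> A \<inter> pos_cone P" by blast
    qed
  qed
  finally show ?thesis .
qed

section \<open>Subdividing a cone near its extreme rays\<close>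

text \<open>The vectors \<open>d k l\<close> witness that \<open>u\<close> is the family of vertices of a nondegenerate simplex. Prescribing
  the inner products with all but one vertex yields the hyperplanes that separate the cones below.\<close>
lemma exists_vector_with_values:
  fixes u :: "'k::finite \<Rightarrow> 'a::euclidean_space"
  assumes dual: "\<And>k l j. d k l \<bullet> u j = of_bool (j = k) - of_bool (j = l)"
  shows "\<exists>a. (\<forall>j. j \<noteq> i \<longrightarrow> a \<bullet> u j = \<alpha> j) \<and> a \<bullet> u i = - (\<Sum>k\<in>UNIV - {i}. \<alpha> k)"
proof (intro exI conjI allI impI)
  let ?a = "\<Sum>k\<in>UNIV - {i}. \<alpha> k *\<^sub>R d k i"
  show "?a \<bullet> u j = \<alpha> j" if "j \<noteq> i" for j
    using that by (simp add: inner_sum_left dual of_bool_def if_distrib[of "\<lambda>y. _ * y"] cong: if_cong)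
  have "?a \<bullet> u i = (\<Sum>k\<in>UNIV - {i}. - \<alpha> k)"
    unfolding inner_sum_left by (rule sum.cong) (auto simp: dual)
  then show "?a \<bullet> u i = - (\<Sum>k\<in>UNIV - {i}. \<alpha> k)"
    by (simp add: sum_negf)
qed

text \<open>A simplex with the vertex zero, at the index \<open>i\<close>, over a part of the facet opposite to \<open>i\<close> of a simplex \<open>u\<close> with centroid zero.
  The centroid \<open>- u i / n\<close> of that facet replaces its vertex \<open>k\<close>. The vertices in \<open>R\<close> are
  kept, the others are moved by the fraction \<open>\<epsilon>\<close> towards the centroid.\<close>
definition flag_simplex ::
  "real \<Rightarrow> ('n option \<Rightarrow> real^'n) \<Rightarrow> 'n option \<Rightarrow> 'n option \<Rightarrow> 'n option set \<Rightarrow> 'n::finite option \<Rightarrow> real^'n" where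
  "flag_simplex \<epsilon> u i k R = (\<lambda>j. if j = i then 0 else if j = k then (- 1 / CARD('n)) *\<^sub>R u i
     else if j \<in> R then u j else (1 - \<epsilon>) *\<^sub>R u j - (\<epsilon> / CARD('n)) *\<^sub>R u i)"

text \<open>The values \<open>hc\<close> and \<open>hw\<close> at the centroid and at the moved vertices determine a linear function on the
  cone whose value at the original vertex is \<open>l j\<close>. The values \<open>hu\<close> at the original vertices may be larger than
  \<open>l\<close> by \<open>\<eta>\<close>, and bounding the volume by them directly would cost \<open>\<eta>\<close>. Cutting the cone along
  the moved vertices, one after the other, confines this loss to thin parts of relative volume
  \<open>\<epsilon>\<close>, so that it is only \<open>\<epsilon> * \<eta>\<close>.\<close>
lemma measure_flag_cone_ge:
  fixes u :: "'n::finite option \<Rightarrow> real^'n" and \<epsilon> \<eta> hc :: real and hw hu l :: "'n option \<Rightarrow> real"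
  assumes dual: "\<And>k l j. d k l \<bullet> u j = of_bool (j = k) - of_bool (j = l)"
    and A: "convex A" "bounded A" "0 \<in> A" and \<epsilon>: "0 < \<epsilon>" "\<epsilon> < 1" and ik: "i \<noteq> k"
    and hc: "0 < hc" "(1 / hc) *\<^sub>R ((- 1 / CARD('n)) *\<^sub>R u i) \<in> A"
    and hw: "\<And>j. j \<noteq> i \<Longrightarrow> 0 < hw j"
      "\<And>j. j \<noteq> i \<Longrightarrow> (1 / hw j) *\<^sub>R ((1 - \<epsilon>) *\<^sub>R u j - (\<epsilon> / CARD('n)) *\<^sub>R u i) \<in> A"
    and hu: "\<And>j. 0 < hu j" "\<And>j. (1 / hu j) *\<^sub>R u j \<in> A"
    and l: "\<And>j. j \<noteq> i \<Longrightarrow> hw j = (1 - \<epsilon>) * l j + \<epsilon> * hc"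
    and \<eta>: "0 \<le> \<eta>" "\<And>j. j \<noteq> i \<Longrightarrow> hu j \<le> l j + \<eta>"
    and R: "R \<subseteq> UNIV - {i, k}"
  shows "hull_volume (flag_simplex \<epsilon> u i k R) *
      (1 + (1 - hc) + (\<Sum>j\<in>UNIV - {i, k}. 1 - (if j \<in> R then l j else hw j)) - CARD('n) * \<epsilon> * \<eta> * card R)
    \<le> measure lebesgue (A \<inter> pos_cone (flag_simplex \<epsilon> u i k R))"
proof -
  have "finite R" by simp
  then show ?thesis using R
  proof (induction R)
    case empty
    define h where "h j = (if j = k then hc else hw j)" for j
    have split: "UNIV - {i} = insert k (UNIV - {i, k})" using ik by auto
    have "hull_volume (flag_simplex \<epsilon> u i k {}) * (1 + (\<Sum>j\<in>UNIV - {i}. 1 - h j))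
        \<le> measure lebesgue (A \<inter> pos_cone (flag_simplex \<epsilon> u i k {}))"
      by (rule measure_cone_ge[OF A]) (use hc hw in \<open>auto simp: flag_simplex_def h_def\<close>)
    moreover have "(\<Sum>j\<in>UNIV - {i}. 1 - h j) = (1 - hc) + (\<Sum>j\<in>UNIV - {i, k}. 1 - hw j)"
      unfolding split by (subst sum.insert) (auto simp: h_def intro: sum.cong)
    ultimately show ?case by (simp add: algebra_simps)
  next
    case (insert m R)
    then have m: "m \<noteq> i" "m \<noteq> k" "m \<notin> R" by auto
    let ?n = "real CARD('n)"
    let ?Q = "flag_simplex \<epsilon> u i k (insert m R)"
    let ?c = "(- 1 / ?n) *\<^sub>R u i"
    let ?w = "(1 - \<epsilon>) *\<^sub>R u m + \<epsilon> *\<^sub>R ?c"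
    let ?V = "hull_volume ?Q"
    have Q: "?Q k = ?c" "?Q m = u m" using m ik by (simp_all add: flag_simplex_def)
    have main: "flag_simplex \<epsilon> u i k R = ?Q(m := ?w)"
      using m by (auto simp: flag_simplex_def fun_eq_iff)
    \<comment> \<open>the thin part that is cut off; it contains the original vertex \<open>u m\<close>\<close>
    define J where "J = ?Q(k := ?w)"
    \<comment> \<open>both parts have the vertex \<open>?w\<close> on the edge of \<open>?Q\<close> from \<open>u m\<close> to \<open>?c\<close>\<close>
    let ?\<mu> = "\<lambda>j. if j = m then 1 - \<epsilon> else if j = k then \<epsilon> else 0"
    have "(\<Sum>j\<in>UNIV. ?\<mu> j) = (\<Sum>j\<in>{m, k}. ?\<mu> j)"
      by (rule sum.mono_neutral_right) auto
    then have \<mu>1: "(\<Sum>j\<in>UNIV. ?\<mu> j) = 1" using m by simp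
    have "(\<Sum>j\<in>UNIV. ?\<mu> j *\<^sub>R ?Q j) = (\<Sum>j\<in>{m, k}. ?\<mu> j *\<^sub>R ?Q j)"
      by (rule sum.mono_neutral_right) auto
    then have \<mu>2: "?w = (\<Sum>j\<in>UNIV. ?\<mu> j *\<^sub>R ?Q j)" using m Q by simp
    have Vmain: "hull_volume (flag_simplex \<epsilon> u i k R) = (1 - \<epsilon>) * ?V"
      unfolding main using hull_volume_replace[OF \<mu>1 \<mu>2, of m] \<epsilon> m by simp
    have VJ: "hull_volume J = \<epsilon> * ?V"
      unfolding J_def using hull_volume_replace[OF \<mu>1 \<mu>2, of k] \<epsilon> m by simp
    define S where "S = (\<Sum>j\<in>UNIV - {i, k} - {m}. 1 - (if j \<in> R then l j else hw j))"
    have split: "UNIV - {i, k} = insert m (UNIV - {i, k} - {m})" "UNIV - {i} = insert k (UNIV - {i, k})"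
      using m ik by auto
    have S1: "(\<Sum>j\<in>UNIV - {i, k}. 1 - (if j \<in> R then l j else hw j)) = (1 - hw m) + S"
      unfolding S_def by (subst split(1), subst sum.insert) (use m in auto)
    have S2: "(\<Sum>j\<in>UNIV - {i, k}. 1 - (if j \<in> insert m R then l j else hw j)) = (1 - l m) + S"
      unfolding S_def by (subst split(1), subst sum.insert) (auto intro: sum.cong)
    have IH: "(1 - \<epsilon>) * ?V * (1 + (1 - hc) + ((1 - hw m) + S) - ?n * \<epsilon> * \<eta> * card R)
        \<le> measure lebesgue (A \<inter> pos_cone (flag_simplex \<epsilon> u i k R))"
      using insert.IH insert.prems unfolding Vmain S1 by simp
    define h where "h j = (if j = k then hw m else if j \<in> insert m R then hu j else hw j)" for j
    have "\<epsilon> * ?V * (1 + (\<Sum>j\<in>UNIV - {i}. 1 - h j)) \<le> measure lebesgue (A \<inter> pos_cone J)"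
      unfolding VJ[symmetric]
    proof (rule measure_cone_ge[OF A])
      show "J i = 0" using ik by (simp add: J_def flag_simplex_def)
      show "0 < h j" if "j \<noteq> i" for j
        using that hw hu m by (simp add: h_def)
      show "(1 / h j) *\<^sub>R J j \<in> A" if "j \<noteq> i" for j
        using that hw(2)[of m] hw(2)[of j] hu(2)[of j] m by (simp add: J_def h_def flag_simplex_def)
    qed
    moreover have "(1 - hw m) + ((1 - l m) + S) - ?n * \<eta> \<le> (\<Sum>j\<in>UNIV - {i}. 1 - h j)"
    proof -
      have "(1 - l m) + S - ?n * \<eta> \<le> (\<Sum>j\<in>UNIV - {i, k}. 1 - (if j \<in> insert m R then l j else hw j))
          - (\<Sum>j\<in>UNIV - {i, k}. \<eta>)"
      proof -
        have "card (UNIV - {i, k}) \<le> CARD('n)"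
          using ik by (simp add: card_Diff_subset)
        then have "(\<Sum>j\<in>UNIV - {i, k}. \<eta>) \<le> ?n * \<eta>"
          using \<eta>(1) by (simp add: mult_right_mono)
        then show ?thesis unfolding S2 by simp
      qed
      also have "\<dots> = (\<Sum>j\<in>UNIV - {i, k}. 1 - (if j \<in> insert m R then l j else hw j) - \<eta>)"
        by (simp only: sum_subtractf)
      also have "\<dots> \<le> (\<Sum>j\<in>UNIV - {i, k}. 1 - h j)"
      proof (rule sum_mono)
        fix j assume "j \<in> UNIV - {i, k}"
        then show "1 - (if j \<in> insert m R then l j else hw j) - \<eta> \<le> 1 - h j"
          using \<eta>(1) \<eta>(2)[of j] by (simp add: h_def)
      qed
      finally show ?thesis
        by (subst split(2), subst sum.insert) (auto simp: h_def)
    qed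
    then have "\<epsilon> * ?V * (1 + ((1 - hw m) + ((1 - l m) + S) - ?n * \<eta>)) \<le> \<epsilon> * ?V * (1 + (\<Sum>j\<in>UNIV - {i}. 1 - h j))"
      using \<epsilon> by (intro mult_left_mono) auto
    ultimately have junk: "\<epsilon> * ?V * (1 + ((1 - hw m) + ((1 - l m) + S) - ?n * \<eta>)) \<le> measure lebesgue (A \<inter> pos_cone J)"
      by linarith
    \<comment> \<open>the normal of the cut: it vanishes on \<open>?w\<close> and on all vertices that both parts share\<close>
    have "\<exists>a. (\<forall>j. j \<noteq> i \<longrightarrow> a \<bullet> u j = (if j = k then ?n * (1 - \<epsilon>) + \<epsilon> * (?n - 1 - card R) else if j \<in> R then 0 else - \<epsilon>)) \<and>
        a \<bullet> u i = - (\<Sum>j\<in>UNIV - {i}. if j = k then ?n * (1 - \<epsilon>) + \<epsilon> * (?n - 1 - card R) else if j \<in> R then 0 else - \<epsilon>)"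
      by (rule exists_vector_with_values[OF dual])
    then obtain a where a: "\<And>j. j \<noteq> i \<Longrightarrow> a \<bullet> u j = (if j = k then ?n * (1 - \<epsilon>) + \<epsilon> * (?n - 1 - card R) else if j \<in> R then 0 else - \<epsilon>)"
      "a \<bullet> u i = - (\<Sum>j\<in>UNIV - {i}. if j = k then ?n * (1 - \<epsilon>) + \<epsilon> * (?n - 1 - card R) else if j \<in> R then 0 else - \<epsilon>)"
      by blast
    have "(\<Sum>j\<in>UNIV - {i, k}. if j \<in> R then 0 else - \<epsilon>) = (\<Sum>j\<in>UNIV - {i, k} - R. - \<epsilon>)"
      by (rule sum.mono_neutral_cong_right) auto
    also have "\<dots> = - \<epsilon> * real (card (UNIV - {i, k} - R))" by simp
    also have "card (UNIV - {i, k} - R) = CARD('n) - 1 - card R"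
      using insert.prems ik by (subst card_Diff_subset) (auto simp: card_Diff_subset)
    also have "real (CARD('n) - 1 - card R) = ?n - 1 - card R"
    proof -
      have "card R \<le> card (UNIV - {i, k})" using insert.prems by (intro card_mono) auto
      also have "\<dots> = CARD('n) - 1" using ik by (simp add: card_Diff_subset)
      finally show ?thesis using zero_less_card_finite[where 'a='n] by linarith
    qed
    finally have rest: "(\<Sum>j\<in>UNIV - {i, k}. if j \<in> R then 0 else - \<epsilon>) = - \<epsilon> * (?n - 1 - card R)" .
    have "(\<Sum>j\<in>UNIV - {i, k}. if j = k then ?n * (1 - \<epsilon>) + \<epsilon> * (?n - 1 - card R) else if j \<in> R then 0 else - \<epsilon>)
        = - \<epsilon> * (?n - 1 - card R)"
      unfolding rest[symmetric] by (rule sum.cong) auto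
    then have "a \<bullet> u i = - (?n * (1 - \<epsilon>))"
      unfolding a(2) by (subst split(2), subst sum.insert) auto
    then have ac: "a \<bullet> ?c = 1 - \<epsilon>" by simp
    then have a0: "a \<noteq> 0" using \<epsilon> by auto
    have aw: "a \<bullet> ?w = 0"
      unfolding inner_add_right inner_scaleR_right[of a "1 - \<epsilon>"] inner_scaleR_right[of a \<epsilon> ?c] ac a(1)[OF m(1)] using m by simp
    have aQ: "a \<bullet> ?Q j = (if j = k then 1 - \<epsilon> else if j = m then - \<epsilon> else 0)" for j
    proof -
      consider "j = i" | "j = k" | "j = m" | "j \<in> R" "j \<noteq> m" "j \<noteq> i" "j \<noteq> k" | "j \<notin> insert m R" "j \<noteq> i" "j \<noteq> k" by auto
      then show ?thesis
      proof cases
        case 5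
        then have "?Q j = (1 - \<epsilon>) *\<^sub>R u j + \<epsilon> *\<^sub>R ?c" by (simp add: flag_simplex_def)
        then show ?thesis
          unfolding inner_add_right using 5 ac a(1)[of j]
          by (simp only: inner_add_right inner_scaleR_right[of a "1 - \<epsilon>"] inner_scaleR_right[of a \<epsilon> ?c]) simp
      qed (use ik m ac a(1) in \<open>simp_all add: flag_simplex_def\<close>)
    qed
    have disj: "negligible (pos_cone (flag_simplex \<epsilon> u i k R) \<inter> pos_cone J)"
    proof (rule negligible_Int_pos_cones[OF a0])
      show "0 \<le> a \<bullet> flag_simplex \<epsilon> u i k R j" for j
        unfolding main using aQ[of j] aw \<epsilon> by auto
      show "a \<bullet> J j \<le> 0" for j
        unfolding J_def using aQ[of j] aw \<epsilon> by auto
    qed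
    have wQ: "?w \<in> pos_cone ?Q"
      using pos_cone_comb[OF pos_cone_generator[of ?Q m] pos_cone_generator[of ?Q k], of "1 - \<epsilon>" \<epsilon>] Q \<epsilon> by simp
    have sub: "pos_cone (?Q(p := ?w)) \<subseteq> pos_cone ?Q" for p
      using wQ pos_cone_generator[of ?Q] by (intro pos_cone_mono) simp
    let ?P = "\<lambda>b. if b then flag_simplex \<epsilon> u i k R else J"
    have "(\<Sum>b\<in>UNIV. measure lebesgue (A \<inter> pos_cone (?P b))) \<le> measure lebesgue (A \<inter> pos_cone ?Q)"
    proof (rule sum_measure_cones_le[OF A(1,2)])
      show "A \<inter> pos_cone ?Q \<in> lmeasurable"
        by (rule lmeasurable_Int_pos_cone[OF A(1,2)])
      show "pos_cone (?P b) \<subseteq> pos_cone ?Q" for b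
        using sub by (simp add: main J_def)
      show "negligible (pos_cone (?P b) \<inter> pos_cone (?P b'))" if "b \<noteq> b'" for b b'
        using that disj by (cases b; cases b') (simp_all add: Int_commute)
    qed simp
    then have "measure lebesgue (A \<inter> pos_cone (flag_simplex \<epsilon> u i k R)) + measure lebesgue (A \<inter> pos_cone J)
        \<le> measure lebesgue (A \<inter> pos_cone ?Q)"
      by (simp add: UNIV_bool)
    moreover have "?V * (1 + (1 - hc) + ((1 - l m) + S) - ?n * \<epsilon> * \<eta> * (card R + 1))
        \<le> (1 - \<epsilon>) * ?V * (1 + (1 - hc) + ((1 - hw m) + S) - ?n * \<epsilon> * \<eta> * card R)
          + \<epsilon> * ?V * (1 + ((1 - hw m) + ((1 - l m) + S) - ?n * \<eta>))"
    proof -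
      have "(1 - \<epsilon>) * (1 + (1 - hc) + ((1 - hw m) + S) - ?n * \<epsilon> * \<eta> * card R)
          + \<epsilon> * (1 + ((1 - hw m) + ((1 - l m) + S) - ?n * \<eta>))
          = 1 + (1 - hc) + ((1 - l m) + S) - ?n * \<epsilon> * \<eta> * (card R + 1) + \<epsilon> * (?n * \<epsilon> * \<eta> * card R)"
        unfolding l[OF m(1)] by (simp add: algebra_simps)
      moreover have "0 \<le> \<epsilon> * (?n * \<epsilon> * \<eta> * card R)" using \<epsilon> \<eta> by simp
      ultimately have "1 + (1 - hc) + ((1 - l m) + S) - ?n * \<epsilon> * \<eta> * (card R + 1)
        \<le> (1 - \<epsilon>) * (1 + (1 - hc) + ((1 - hw m) + S) - ?n * \<epsilon> * \<eta> * card R)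
          + \<epsilon> * (1 + ((1 - hw m) + ((1 - l m) + S) - ?n * \<eta>))" by linarith
      from mult_left_mono[OF this, of ?V] show ?thesis by (simp add: algebra_simps)
    qed
    ultimately show ?case
      unfolding S2 using IH junk m insert.hyps by simp
  qed
qed

section \<open>Volume of a convex set close to a simplex\<close>

lemma card_UNIV_option_real: "real CARD('n::finite option) = real CARD('n) + 1"
  by (simp add: UNIV_option_conv card_image)

lemma hull_volume_flag_simplex:
  fixes u :: "'n::finite option \<Rightarrow> real^'n"
  assumes u0: "(\<Sum>j\<in>UNIV. u j) = 0" and ik: "i \<noteq> k"
  shows "hull_volume (flag_simplex \<epsilon> u i k (UNIV - {i, k})) = hull_volume u / (real CARD('n) * (real CARD('n) + 1))"
proof -
  let ?n = "real CARD('n)"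
  let ?c = "(- 1 / ?n) *\<^sub>R u i"
  have n: "?n > 0" by simp
  have one: "(\<Sum>j\<in>(UNIV :: 'n option set). 1 / (?n + 1)) = 1"
    using n by (simp add: card_UNIV_option_real[where 'n='n] del: card_option)
  have zero: "0 = (\<Sum>j\<in>UNIV. (1 / (?n + 1)) *\<^sub>R u j)"
    by (simp add: scaleR_sum_right[symmetric] u0)
  have V0: "hull_volume (u(i := 0)) = hull_volume u / (?n + 1)"
    using hull_volume_replace[OF one zero, of i] n by simp
  let ?\<mu> = "\<lambda>j. if j = i then 0 else 1 / ?n"
  have split: "UNIV = insert i (UNIV - {i})" by auto
  have "(\<Sum>j\<in>UNIV. ?\<mu> j) = (\<Sum>j\<in>UNIV - {i}. 1 / ?n)"
    by (subst split, subst sum.insert) auto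
  also have "\<dots> = 1" using n by (simp add: card_Diff_subset)
  finally have \<mu>1: "(\<Sum>j\<in>UNIV. ?\<mu> j) = 1" .
  have "(\<Sum>j\<in>UNIV. ?\<mu> j *\<^sub>R (u(i := 0)) j) = (\<Sum>j\<in>UNIV - {i}. (1 / ?n) *\<^sub>R u j)"
    by (subst split, subst sum.insert) auto
  also have "\<dots> = (1 / ?n) *\<^sub>R (\<Sum>j\<in>UNIV - {i}. u j)"
    by (simp add: scaleR_sum_right)
  also have "(\<Sum>j\<in>UNIV - {i}. u j) = - u i"
    using u0 by (simp add: sum_diff1)
  finally have \<mu>2: "?c = (\<Sum>j\<in>UNIV. ?\<mu> j *\<^sub>R (u(i := 0)) j)" by simp
  have "flag_simplex \<epsilon> u i k (UNIV - {i, k}) = (u(i := 0))(k := ?c)"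
    using ik by (auto simp: flag_simplex_def fun_eq_iff)
  then have "hull_volume (flag_simplex \<epsilon> u i k (UNIV - {i, k})) = \<bar>?\<mu> k\<bar> * hull_volume (u(i := 0))"
    by (simp only: hull_volume_replace[OF \<mu>1 \<mu>2, of k])
  also have "\<bar>?\<mu> k\<bar> = 1 / ?n" using ik by simp
  finally show ?thesis unfolding V0 by simp
qed

text \<open>Cones over different facets are separated by a hyperplane on which two barycentric coordinates
  agree, and so are the cones over one facet.\<close>
lemma negligible_Int_flag_cones:
  fixes u :: "'n::finite option \<Rightarrow> real^'n"
  assumes dual: "\<And>k l j. d k l \<bullet> u j = of_bool (j = k) - of_bool (j = l)"
    and "i \<noteq> k" "i' \<noteq> k'" "(i, k) \<noteq> (i', k')"
  shows "negligible (pos_cone (flag_simplex \<epsilon> u i k (UNIV - {i, k})) \<inter> pos_cone (flag_simplex \<epsilon> u i' k' (UNIV - {i', k'})))"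
proof -
  have F: "flag_simplex \<epsilon> u i k (UNIV - {i, k}) j = (if j = i then 0 else if j = k then (- 1 / CARD('n)) *\<^sub>R u i else u j)" for i k j
    by (simp add: flag_simplex_def)
  have ne: "d k l \<noteq> 0" if "k \<noteq> l" for k l
    using dual[of k l k] that by auto
  show ?thesis
  proof (cases "i = i'")
    case False
    show ?thesis
      by (rule negligible_Int_pos_cones[of "d i' i"]) (use False ne in \<open>auto simp: F dual\<close>)
  next
    case True
    then have "k \<noteq> k'" using assms by simp
    then show ?thesis
      using True assms by (intro negligible_Int_pos_cones[of "d k' k"]) (auto simp: F dual ne)
  qed
qed

text \<open>First order lower bound for the volume of a convex set in terms of upper bounds \<open>hc\<close>, \<open>hw\<close>, \<open>hu\<close> of its gauge at
  the facet centroids, near the vertices inside each facet, and at the vertices. The pairs \<open>(i, k)\<close>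
  enumerate the cones of the centroid subdivision of all facets. All of them have the same volume,
  whence the equal weights on which the cancellation in the main argument rests.\<close>
lemma measure_ge_perturbed_simplex:
  fixes u :: "'n::finite option \<Rightarrow> real^'n" and \<epsilon> \<eta> :: real and hc hu :: "'n option \<Rightarrow> real"
    and hw l :: "'n option \<Rightarrow> 'n option \<Rightarrow> real"
  assumes u0: "(\<Sum>j\<in>UNIV. u j) = 0"
    and dual: "\<And>k l j. d k l \<bullet> u j = of_bool (j = k) - of_bool (j = l)"
    and A: "convex A" "bounded A" "0 \<in> A" and \<epsilon>: "0 < \<epsilon>" "\<epsilon> < 1"
    and hc: "\<And>i. 0 < hc i" "\<And>i. (1 / hc i) *\<^sub>R ((- 1 / CARD('n)) *\<^sub>R u i) \<in> A"
    and hw: "\<And>i j. j \<noteq> i \<Longrightarrow> 0 < hw i j"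
      "\<And>i j. j \<noteq> i \<Longrightarrow> (1 / hw i j) *\<^sub>R ((1 - \<epsilon>) *\<^sub>R u j - (\<epsilon> / CARD('n)) *\<^sub>R u i) \<in> A"
    and hu: "\<And>j. 0 < hu j" "\<And>j. (1 / hu j) *\<^sub>R u j \<in> A"
    and l: "\<And>i j. j \<noteq> i \<Longrightarrow> hw i j = (1 - \<epsilon>) * l i j + \<epsilon> * hc i"
    and \<eta>: "0 \<le> \<eta>" "\<And>i j. j \<noteq> i \<Longrightarrow> hu j \<le> l i j + \<eta>"
  shows "hull_volume u * (1 + (\<Sum>i\<in>UNIV. 1 - hc i) / (real CARD('n) + 1)
      + (real CARD('n) - 1) / (real CARD('n) * (real CARD('n) + 1)) * (\<Sum>i\<in>UNIV. \<Sum>j\<in>UNIV - {i}. 1 - l i j)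
      - (real CARD('n))\<^sup>2 * \<epsilon> * \<eta>) \<le> measure lebesgue A"
proof -
  let ?n = "real CARD('n)"
  let ?V = "hull_volume u / (?n * (?n + 1))"
  define I where "I = (SIGMA i:(UNIV :: 'n option set). UNIV - {i})"
  define P where "P = (\<lambda>(i, k). flag_simplex \<epsilon> u i k (UNIV - {i, k}))"
  have n: "?n > 0" by simp
  have I: "i \<noteq> k" if "(i, k) \<in> I" for i k using that by (auto simp: I_def)
  have ck: "card (UNIV - {i :: 'n option}) = CARD('n)" for i
    by (simp add: card_Diff_subset)
  have c2: "real (card (UNIV - {i, k :: 'n option})) = ?n - 1" if "i \<noteq> k" for i k
  proof -
    have "card (UNIV - {i, k}) = CARD('n) - 1" using that by (simp add: card_Diff_subset)
    then show ?thesis using n by (simp add: of_nat_diff Suc_leI)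
  qed
  have "(\<Sum>p\<in>I. measure lebesgue (A \<inter> pos_cone (P p))) \<le> measure lebesgue (A \<inter> UNIV)"
  proof (rule sum_measure_cones_le[OF A(1,2)])
    show "finite I" by (simp add: I_def)
    show "A \<inter> UNIV \<in> lmeasurable" using A by (simp add: measurable_convex)
    show "negligible (pos_cone (P p) \<inter> pos_cone (P q))" if "p \<in> I" "q \<in> I" "p \<noteq> q" for p q
    proof -
      obtain i k i' k' where "p = (i, k)" "q = (i', k')" by fastforce
      then show ?thesis
        using that I negligible_Int_flag_cones[OF dual, of i k i' k' \<epsilon>] by (auto simp: P_def)
    qed
  qed simp
  moreover have "(\<Sum>(i, k)\<in>I. ?V * (1 + (1 - hc i) + (\<Sum>j\<in>UNIV - {i, k}. 1 - l i j) - ?n * \<epsilon> * \<eta> * (?n - 1)))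
      \<le> (\<Sum>p\<in>I. measure lebesgue (A \<inter> pos_cone (P p)))"
  proof (rule sum_mono, clarify)
    fix i k assume "(i, k) \<in> I"
    then have ik: "i \<noteq> k" by (rule I)
    have "hull_volume (flag_simplex \<epsilon> u i k (UNIV - {i, k})) *
      (1 + (1 - hc i) + (\<Sum>j\<in>UNIV - {i, k}. 1 - (if j \<in> UNIV - {i, k} then l i j else hw i j)) - ?n * \<epsilon> * \<eta> * card (UNIV - {i, k}))
      \<le> measure lebesgue (A \<inter> pos_cone (flag_simplex \<epsilon> u i k (UNIV - {i, k})))"
      by (rule measure_flag_cone_ge[OF dual A \<epsilon> ik hc hw hu l \<eta> subset_refl]) auto
    moreover have "(\<Sum>j\<in>UNIV - {i, k}. 1 - (if j \<in> UNIV - {i, k} then l i j else hw i j)) = (\<Sum>j\<in>UNIV - {i, k}. 1 - l i j)"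
      by (rule sum.cong) auto
    ultimately show "?V * (1 + (1 - hc i) + (\<Sum>j\<in>UNIV - {i, k}. 1 - l i j) - ?n * \<epsilon> * \<eta> * (?n - 1))
        \<le> measure lebesgue (A \<inter> pos_cone (P (i, k)))"
      by (simp only: hull_volume_flag_simplex[OF u0 ik] c2[OF ik] P_def prod.case)
  qed
  moreover have "(\<Sum>(i, k)\<in>I. ?V * (1 + (1 - hc i) + (\<Sum>j\<in>UNIV - {i, k}. 1 - l i j) - ?n * \<epsilon> * \<eta> * (?n - 1)))
     = hull_volume u * (1 + (\<Sum>i\<in>UNIV. 1 - hc i) / (?n + 1)
      + (?n - 1) / (?n * (?n + 1)) * (\<Sum>i\<in>UNIV. \<Sum>j\<in>UNIV - {i}. 1 - l i j) - ?n * (?n - 1) * \<epsilon> * \<eta>)"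
  proof -
    have inner: "(\<Sum>k\<in>UNIV - {i}. \<Sum>j\<in>UNIV - {i, k}. 1 - l i j) = (?n - 1) * (\<Sum>j\<in>UNIV - {i}. 1 - l i j)" for i
    proof -
      have "(\<Sum>j\<in>UNIV - {i, k}. 1 - l i j) = (\<Sum>j\<in>UNIV - {i}. 1 - l i j) - (1 - l i k)" if "k \<in> UNIV - {i}" for k
      proof -
        have "UNIV - {i, k} = UNIV - {i} - {k}" by auto
        then show ?thesis
          using sum.remove[of "UNIV - {i}" k "\<lambda>j. 1 - l i j"] that by simp
      qed
      then have "(\<Sum>k\<in>UNIV - {i}. \<Sum>j\<in>UNIV - {i, k}. 1 - l i j)
          = (\<Sum>k\<in>UNIV - {i}. (\<Sum>j\<in>UNIV - {i}. 1 - l i j) - (1 - l i k))"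
        by (rule sum.cong[OF refl])
      also have "\<dots> = ?n * (\<Sum>j\<in>UNIV - {i}. 1 - l i j) - (\<Sum>k\<in>UNIV - {i}. 1 - l i k)"
        by (simp only: sum_subtractf[of "\<lambda>_. \<Sum>j\<in>UNIV - {i}. 1 - l i j"] sum_constant ck)
      finally show ?thesis by (simp add: left_diff_distrib)
    qed
    define B where "B i = (\<Sum>j\<in>UNIV - {i}. 1 - l i j)" for i
    define e where "e = ?n * \<epsilon> * \<eta> * (?n - 1)"
    have "(\<Sum>(i, k)\<in>I. ?V * (1 + (1 - hc i) + (\<Sum>j\<in>UNIV - {i, k}. 1 - l i j) - e))
       = ?V * (\<Sum>(i, k)\<in>I. (1 - e + (1 - hc i)) + (\<Sum>j\<in>UNIV - {i, k}. 1 - l i j))"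
    proof -
      have "a * (1 + b + c - e) = a * ((1 - e + b) + c)" for a b c :: real by simp
      then show ?thesis
        unfolding sum_distrib_left by (intro sum.cong refl) (simp only: split_def)
    qed
    also have "(\<Sum>(i, k)\<in>I. (1 - e + (1 - hc i)) + (\<Sum>j\<in>UNIV - {i, k}. 1 - l i j))
       = (\<Sum>i\<in>UNIV. \<Sum>k\<in>UNIV - {i}. (1 - e + (1 - hc i)) + (\<Sum>j\<in>UNIV - {i, k}. 1 - l i j))"
      unfolding I_def by (rule sum.Sigma[symmetric]) auto
    also have "\<dots> = (\<Sum>i\<in>UNIV. ?n * (1 - e + (1 - hc i)) + (?n - 1) * B i)"
      by (rule sum.cong[OF refl]) (simp only: sum.distrib sum_constant ck inner B_def distrib_left)
    also have "\<dots> = (?n + 1) * ?n * (1 - e) + ?n * (\<Sum>i\<in>UNIV. 1 - hc i) + (?n - 1) * (\<Sum>i\<in>UNIV. B i)"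
      by (simp only: distrib_left[of ?n] sum.distrib sum_constant sum_distrib_left[symmetric] card_UNIV_option_real[where 'n='n])
    finally have eq: "(\<Sum>(i, k)\<in>I. ?V * (1 + (1 - hc i) + (\<Sum>j\<in>UNIV - {i, k}. 1 - l i j) - e))
      = ?V * ((?n + 1) * ?n * (1 - e) + ?n * (\<Sum>i\<in>UNIV. 1 - hc i) + (?n - 1) * (\<Sum>i\<in>UNIV. B i))" .
    have "v / (x * (x + 1)) * ((x + 1) * x * (1 - e) + x * c + (x - 1) * b)
      = v * (1 + c / (x + 1) + (x - 1) / (x * (x + 1)) * b - e)" if "x > 0" for v x c b :: real
      using that by (simp add: divide_simps) (simp add: algebra_simps)
    from eq[unfolded this[OF n]] show ?thesis
      unfolding B_def e_def by (simp only: mult_ac)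
  qed
  moreover have "hull_volume u * (1 + (\<Sum>i\<in>UNIV. 1 - hc i) / (?n + 1)
      + (?n - 1) / (?n * (?n + 1)) * (\<Sum>i\<in>UNIV. \<Sum>j\<in>UNIV - {i}. 1 - l i j) - ?n\<^sup>2 * \<epsilon> * \<eta>)
     \<le> hull_volume u * (1 + (\<Sum>i\<in>UNIV. 1 - hc i) / (?n + 1)
      + (?n - 1) / (?n * (?n + 1)) * (\<Sum>i\<in>UNIV. \<Sum>j\<in>UNIV - {i}. 1 - l i j) - ?n * (?n - 1) * \<epsilon> * \<eta>)"
  proof (rule mult_left_mono)
    have "0 \<le> ?n * \<epsilon> * \<eta>" using \<epsilon> \<eta> by simp
    then show "1 + (\<Sum>i\<in>UNIV. 1 - hc i) / (?n + 1)
      + (?n - 1) / (?n * (?n + 1)) * (\<Sum>i\<in>UNIV. \<Sum>j\<in>UNIV - {i}. 1 - l i j) - ?n\<^sup>2 * \<epsilon> * \<eta>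
     \<le> 1 + (\<Sum>i\<in>UNIV. 1 - hc i) / (?n + 1)
      + (?n - 1) / (?n * (?n + 1)) * (\<Sum>i\<in>UNIV. \<Sum>j\<in>UNIV - {i}. 1 - l i j) - ?n * (?n - 1) * \<epsilon> * \<eta>"
      by (simp add: power2_eq_square algebra_simps)
  qed simp
  ultimately show ?thesis unfolding Int_UNIV_right by linarith
qed

section \<open>A body that contains the standard simplex\<close>

text \<open>The remainder \<open>p - \<beta> *\<^sub>R x\<close> is a multiple of a point of the standard simplex. It shows below how a single
  extremal point \<open>x\<close> of \<open>K\<close> pushes \<open>K\<close> outwards in a prescribed direction.\<close>
lemma in_convex_if_bary_ge:
  fixes K :: "(real^'n::finite) set"
  assumes K: "convex K" "range std_vertex \<subseteq> K" and x: "x \<in> K" and \<beta>: "0 \<le> \<beta>" "\<beta> < 1"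
    and p: "\<And>k. \<beta> * bary k x \<le> bary k p"
  shows "p \<in> K"
proof -
  define q where "q = (1 / (1 - \<beta>)) *\<^sub>R (p - \<beta> *\<^sub>R x)"
  have pq: "p = \<beta> *\<^sub>R x + (1 - \<beta>) *\<^sub>R q"
    using \<beta> by (simp add: q_def)
  have "bary k p = \<beta> * bary k x + (1 - \<beta>) * bary k q" for k
    unfolding pq by (rule bary_combine) simp
  with p have "0 \<le> (1 - \<beta>) * bary k q" for k
    by (metis add_le_cancel_left add.right_neutral)
  then have "\<forall>k. 0 \<le> bary k q"
    using \<beta> by (simp add: zero_le_mult_iff)
  then have "q \<in> convex hull (range std_vertex)"
    by (simp add: std_simplex_eq)
  then have "q \<in> K"
    using hull_minimal[of "range std_vertex" K convex] K by blast
  then show ?thesis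
    unfolding pq using K(1) x \<beta> by (intro convexD) auto
qed

definition centroid :: "real^'n::finite" where
  "centroid = (\<Sum>k\<in>UNIV. (1 / (real CARD('n) + 1)) *\<^sub>R std_vertex k)"

lemma bary_centroid: "bary k (centroid :: real^'n::finite) = 1 / (real CARD('n) + 1)"
proof -
  have "(\<Sum>j\<in>(UNIV :: 'n option set). 1 / (real CARD('n) + 1)) = 1"
    by (simp add: card_UNIV_option_real[where 'n='n] del: card_option)
  then show ?thesis
    unfolding centroid_def
    by (subst bary_affine) (simp_all add: bary_std_vertex of_bool_def if_distrib[of "\<lambda>y. y / _"] cong: if_cong)
qed

lemma sum_std_vertex_minus_centroid: "(\<Sum>k\<in>UNIV. std_vertex k - (centroid :: real^'n::finite)) = 0"
proof -
  let ?N = "real CARD('n) + 1"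
  have "(\<Sum>k\<in>(UNIV :: 'n option set). centroid :: real^'n) = ?N *\<^sub>R centroid"
    unfolding sum_constant_scaleR card_UNIV_option_real ..
  also have "\<dots> = (\<Sum>k\<in>UNIV. std_vertex k)"
    by (simp add: centroid_def scaleR_sum_right[symmetric])
  finally show ?thesis by (simp add: sum_subtractf)
qed

lemma bary_from_centroid:
  "bary k (centroid + r *\<^sub>R (a *\<^sub>R (std_vertex j - centroid) - b *\<^sub>R (std_vertex i - centroid)))
    = 1 / (real CARD('n) + 1) + r * (a * (of_bool (k = j) - 1 / (real CARD('n) + 1)) - b * (of_bool (k = i) - 1 / (real CARD('n) + 1)))"
  for i :: "'n::finite option"
proof -
  have v: "bary k (centroid + v) = bary k centroid - facet_normal k \<bullet> v" for v :: "real^'n"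
    using facet_normal_inner[of k "centroid + v" centroid] by simp
  show ?thesis
    unfolding v inner_scaleR_right inner_diff_right[of _ "a *\<^sub>R _"] facet_normal_inner bary_centroid bary_std_vertex
    by (simp add: algebra_simps)
qed

text \<open>For small \<open>\<epsilon>\<close> its maximum over a body close to the standard simplex is attained close to the vertex
  \<open>i\<close>; there it measures how far the body exceeds the facet opposite to \<open>j\<close>. On the simplex itself the maximum is
  \<open>\<epsilon> / n\<close>, attained at the vertex \<open>i\<close>.\<close>
definition vertex_functional :: "real \<Rightarrow> 'n::finite option \<Rightarrow> 'n option \<Rightarrow> real^'n \<Rightarrow> real" where
  "vertex_functional \<epsilon> i j x = \<epsilon> / CARD('n) * bary i x - (1 - \<epsilon>) * bary j x"

text \<open>Volume of \<open>K\<close>. The maximizer \<open>x i j\<close> of a vertex functional pushes \<open>K\<close> outwards by \<open>S i j\<close> above the facet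
  \<open>j\<close> near the vertex \<open>i\<close>, and the point \<open>y\<close> at depth \<open>t\<close> behind the facet \<open>m\<close> pushes it outwards by a multiple of \<open>t\<close> above the
  centroid of that facet. The latter is the gain that survives in the volume product.\<close>
lemma measure_ge_inscribed:
  fixes K :: "(real^'n::finite) set" and S :: "'n option \<Rightarrow> 'n option \<Rightarrow> real"
  defines "n \<equiv> real CARD('n)" and "N \<equiv> real CARD('n) + 1"
  assumes K: "convex K" "bounded K" "range std_vertex \<subseteq> K"
    and b1: "\<And>k x. x \<in> K \<Longrightarrow> bary k x \<le> 1" and b\<tau>: "\<And>k x. x \<in> K \<Longrightarrow> - \<tau> \<le> bary k x"
    and \<epsilon>: "0 < \<epsilon>" "4 * n * \<epsilon> \<le> 1" and \<tau>: "(n / \<epsilon> + n + 2) * \<tau> \<le> \<epsilon> / n"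
    and S: "\<And>i j. i \<noteq> j \<Longrightarrow> 0 \<le> S i j" "\<And>i j. i \<noteq> j \<Longrightarrow> S i j \<le> \<tau>"
    and x: "\<And>i j. i \<noteq> j \<Longrightarrow> x i j \<in> K" "\<And>i j. i \<noteq> j \<Longrightarrow> vertex_functional \<epsilon> i j (x i j) = \<epsilon> / n + S i j"
    and y: "y \<in> K" "bary m y = - t" "0 \<le> t" "t \<le> 1"
  shows "1 + (n - 1) / (n * (1 - \<epsilon>)) * (\<Sum>i\<in>UNIV. \<Sum>j\<in>UNIV - {i}. S j i) + t / (6 * N)
    - 2 * n * N\<^sup>2 * \<tau>\<^sup>2 - 2 * n\<^sup>2 * N * \<epsilon> * \<tau> \<le> fact CARD('n) * measure lebesgue K"
proof -
  have n1: "1 \<le> n" unfolding n_def by (simp add: Suc_leI)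
  have N: "N = n + 1" "N \<ge> 2" using n1 by (simp_all add: N_def n_def)
  have \<epsilon>': "\<epsilon> \<le> 1 / 4" "\<epsilon> < 1"
  proof -
    have "1 * \<epsilon> \<le> n * \<epsilon>" using n1 \<epsilon> by (intro mult_right_mono) auto
    then show "\<epsilon> \<le> 1 / 4" using \<epsilon>(2) unfolding mult.assoc by linarith
    then show "\<epsilon> < 1" by simp
  qed
  have \<tau>0: "0 \<le> \<tau>"
    using S[of None "Some undefined"] by simp
  define u :: "'n option \<Rightarrow> real^'n" where "u = (\<lambda>k. std_vertex k - centroid)"
  define A where "A = (\<lambda>x. x - centroid) ` K"
  have memA: "v \<in> A" if "centroid + v \<in> K" for v
    unfolding A_def using that by (metis add_diff_cancel_left' image_eqI)
  have KT: "p \<in> K" if "\<And>k. 0 \<le> bary k p" for p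
  proof (rule in_convex_if_bary_ge[OF K(1,3)])
    show "std_vertex None \<in> K" using K(3) by blast
    show "0 * bary k (std_vertex None) \<le> bary k p" for k using that by simp
  qed auto
  \<comment> \<open>the stretching at the centroid of facet \<open>m\<close>; the weight \<open>1 / (2 * n)\<close> of \<open>y\<close> still leaves room in the facet\<close>
  define a where "a = N * t / (2 * n)"
  have a: "t / 2 \<le> a" "a \<le> t" "0 \<le> a"
  proof -
    have "t * n \<le> t * N" using y(3) N by (intro mult_left_mono) auto
    then show "t / 2 \<le> a" using n1 by (simp add: a_def field_simps)
    have "t * N \<le> t * (2 * n)" using y(3) N n1 by (intro mult_left_mono) auto
    then show "a \<le> t" using n1 by (simp add: a_def field_simps)
    show "0 \<le> a" using y(3) n1 N by (simp add: a_def)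
  qed
  define hc where "hc i = (if i = m then 1 / (1 + a) else 1)" for i
  define hw where "hw i j = 1 / (1 + N * S j i)" for i j
  define l where "l i j = (hw i j - \<epsilon> * hc i) / (1 - \<epsilon>)" for i j
  have NS: "0 \<le> N * S j i" if "i \<noteq> j" for i j using S(1)[of j i] that N by simp
  have bp: "bary k (centroid + r *\<^sub>R (\<alpha> *\<^sub>R u j - \<beta> *\<^sub>R u i))
      = 1 / N + r * (\<alpha> * (of_bool (k = j) - 1 / N) - \<beta> * (of_bool (k = i) - 1 / N))" for k r \<alpha> \<beta> i j
    unfolding u_def N_def by (rule bary_from_centroid)
  have bc: "bary k (centroid + r *\<^sub>R ((- 1 / n) *\<^sub>R u i)) = (1 - r) / N + (if k = i then 0 else r / n)" for k r i
  proof -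
    have "1 / N + r * (0 - 1 / n * (of_bool (k = i) - 1 / N)) = (1 - r) / N + (if k = i then 0 else r / n)"
      using n1 unfolding N(1) by (simp add: divide_simps) (simp add: algebra_simps)
    then show ?thesis using bp[of k r 0 i "1 / n" i] by simp
  qed
  have hcA: "0 < hc i \<and> (1 / hc i) *\<^sub>R ((- 1 / n) *\<^sub>R u i) \<in> A" for i
  proof (cases "i = m")
    case False
    then show ?thesis
      using bc[of _ 1 i] n1 by (auto simp: hc_def intro!: memA KT)
  next
    case True
    have "centroid + (1 + a) *\<^sub>R ((- 1 / n) *\<^sub>R u m) \<in> K"
    proof (rule in_convex_if_bary_ge[OF K(1,3) y(1)])
      show "0 \<le> 1 / (2 * n)" "1 / (2 * n) < 1" using n1 by auto
      fix k
      have e: "(1 - (1 + a)) / N = - t / (2 * n)" using N n1 by (simp add: a_def)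
      show "1 / (2 * n) * bary k y \<le> bary k (centroid + (1 + a) *\<^sub>R ((- 1 / n) *\<^sub>R u m))"
      proof (cases "k = m")
        case True
        then show ?thesis unfolding bc e using y(2) by simp
      next
        case False
        have "1 / (2 * n) * bary k y \<le> 1 / (2 * n) * 1"
          using b1[OF y(1), of k] n1 by (intro mult_left_mono) auto
        also have "\<dots> \<le> - t / (2 * n) + (1 + a) / n"
        proof -
          have "- t / (2 * n) + (1 + a) / n = (2 + 2 * a - t) / (2 * n)"
            using n1 by (simp add: divide_simps)
          moreover have "1 / (2 * n) \<le> (2 + 2 * a - t) / (2 * n)"
            using y a n1 by (intro divide_right_mono) auto
          ultimately show ?thesis by simp
        qed
        finally show ?thesis unfolding bc e using False by simp
      qed
    qed
    then show ?thesis using True a by (simp add: hc_def memA)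
  qed
  have hwA: "0 < hw i j \<and> (1 / hw i j) *\<^sub>R ((1 - \<epsilon>) *\<^sub>R u j - (\<epsilon> / n) *\<^sub>R u i) \<in> A" if ji: "j \<noteq> i" for i j
  proof -
    let ?x = "x j i" and ?s = "S j i"
    define r where "r = 1 + N * ?s"
    have s: "0 \<le> ?s" "?s \<le> \<tau>" using S[of j i] ji by auto
    have xK: "?x \<in> K" using x(1) ji by blast
    have phi: "\<epsilon> / n * bary j ?x - (1 - \<epsilon>) * bary i ?x = \<epsilon> / n + ?s"
      using x(2)[OF ji] by (simp add: vertex_functional_def n_def)
    have r: "(1 - r) / N = - ?s" "1 \<le> r" using N s by (simp_all add: r_def)
    have alg: "1 / N + r * ((1 - \<epsilon>) * (1 - 1 / N) + \<epsilon> / n * (1 / N)) = (1 - r) / N + r * (1 - \<epsilon>) + r * \<epsilon> / n"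
      "1 / N + r * (- ((1 - \<epsilon>) * (1 / N)) - \<epsilon> / n * (1 - 1 / N)) = (1 - r) / N"
      "1 / N + r * (- ((1 - \<epsilon>) * (1 / N)) + \<epsilon> / n * (1 / N)) = (1 - r) / N + r * \<epsilon> / n"
      using n1 unfolding N(1) by (simp_all add: divide_simps) (simp_all add: algebra_simps)
    have b: "bary k (centroid + r *\<^sub>R ((1 - \<epsilon>) *\<^sub>R u j - (\<epsilon> / n) *\<^sub>R u i)) =
       (if k = i then - ?s else if k = j then - ?s + r * (1 - \<epsilon>) + r * \<epsilon> / n else - ?s + r * \<epsilon> / n)" for k
      unfolding bp r(1)[symmetric] using ji alg by (auto simp: mult.commute[of n N])
    have "centroid + r *\<^sub>R ((1 - \<epsilon>) *\<^sub>R u j - (\<epsilon> / n) *\<^sub>R u i) \<in> K"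
    proof (rule in_convex_if_bary_ge[OF K(1,3) xK])
      show "0 \<le> 1 - \<epsilon>" "1 - \<epsilon> < 1" using \<epsilon> \<epsilon>' by auto
      fix k
      have bj1: "\<epsilon> / n * bary j ?x \<le> \<epsilon> / n * 1"
        using b1[OF xK, of j] \<epsilon> n1 by (intro mult_left_mono) auto
      consider "k = i" | "k = j" | "k \<noteq> i" "k \<noteq> j" by blast
      then show "(1 - \<epsilon>) * bary k ?x \<le> bary k (centroid + r *\<^sub>R ((1 - \<epsilon>) *\<^sub>R u j - (\<epsilon> / n) *\<^sub>R u i))"
      proof cases
        case 1
        then show ?thesis unfolding b using phi bj1 by simp
      next
        case 2
        have "(1 - \<epsilon>) * bary j ?x \<le> (1 - \<epsilon>) * 1"
          using b1[OF xK, of j] \<epsilon>' by (intro mult_left_mono) auto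
        also have "\<dots> \<le> - ?s + r * (1 - \<epsilon>) + r * \<epsilon> / n"
        proof -
          have "?s * 1 \<le> ?s * (N * (1 - \<epsilon>))"
          proof (rule mult_left_mono)
            have "2 * (3 / 4) \<le> N * (1 - \<epsilon>)" using N \<epsilon>' by (intro mult_mono) auto
            then show "1 \<le> N * (1 - \<epsilon>)" by simp
          qed (rule s)
          moreover have "0 \<le> r * \<epsilon> / n" using r \<epsilon> n1 by simp
          ultimately show ?thesis by (simp add: r_def algebra_simps)
        qed
        finally show ?thesis unfolding b using 2 ji by simp
      next
        case 3
        have "(1 - \<epsilon>) * - bary i ?x \<le> 1 * \<tau>"
          using b\<tau>[OF xK, of i] \<epsilon> \<epsilon>' \<tau>0
          by (metis (no_types, opaque_lifting) diff_ge_0_iff_ge dual_order.trans less_eq_real_def minus_le_iff mult.commute mult_left_mono mult_right_le_one_le mult_1 diff_le_eq le_add_same_cancel1)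
        then have "\<epsilon> / n - \<tau> \<le> \<epsilon> / n * bary j ?x" using phi s by simp
        \<comment> \<open>the maximizer lies within distance of order \<open>\<tau> / \<epsilon>\<close> of the vertex \<open>j\<close>, so the other coordinates are small\<close>
        then have "(n / \<epsilon>) * (\<epsilon> / n - \<tau>) \<le> (n / \<epsilon>) * (\<epsilon> / n * bary j ?x)"
          using \<epsilon> n1 by (intro mult_left_mono) auto
        then have bj: "1 - n / \<epsilon> * \<tau> \<le> bary j ?x"
          using \<epsilon> n1 by (simp add: right_diff_distrib)
        have "1 = bary k ?x + bary j ?x + (\<Sum>q\<in>UNIV - {k, j}. bary q ?x)"
        proof -
          have "UNIV = insert k (insert j (UNIV - {k, j}))" by auto
          then have "(\<Sum>q\<in>UNIV. bary q ?x) = (\<Sum>q\<in>insert k (insert j (UNIV - {k, j})). bary q ?x)" by simp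
          also have "\<dots> = bary k ?x + bary j ?x + (\<Sum>q\<in>UNIV - {k, j}. bary q ?x)"
            using 3 by (subst sum.insert, simp, simp, subst sum.insert) auto
          finally show ?thesis by simp
        qed
        moreover have "- (n * \<tau>) \<le> (\<Sum>q\<in>UNIV - {k, j}. bary q ?x)"
        proof -
          have "real (card (UNIV - {k, j})) \<le> n"
            using 3 by (simp add: n_def card_Diff_subset)
          then have "- (n * \<tau>) \<le> (\<Sum>q\<in>UNIV - {k, j}. - \<tau>)"
            using \<tau>0 by (simp add: mult_right_mono)
          also have "\<dots> \<le> (\<Sum>q\<in>UNIV - {k, j}. bary q ?x)"
            by (intro sum_mono b\<tau>[OF xK])
          finally show ?thesis .
        qed
        ultimately have "bary k ?x \<le> n / \<epsilon> * \<tau> + n * \<tau>" using bj by linarith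
        then have "(1 - \<epsilon>) * bary k ?x \<le> (1 - \<epsilon>) * (n / \<epsilon> * \<tau> + n * \<tau>)"
          using \<epsilon>' by (intro mult_left_mono) auto
        also have "\<dots> \<le> 1 * (n / \<epsilon> * \<tau> + n * \<tau>)"
          using \<epsilon> n1 \<tau>0 by (intro mult_right_mono) auto
        also have "\<dots> \<le> \<epsilon> / n - \<tau>"
          using \<tau> \<tau>0 by (simp add: algebra_simps)
        also have "\<dots> \<le> - ?s + r * \<epsilon> / n"
        proof -
          have "\<epsilon> / n * 1 \<le> \<epsilon> / n * r" using r \<epsilon> n1 by (intro mult_left_mono) auto
          then show ?thesis using s by (simp add: mult.commute)
        qed
        finally show ?thesis unfolding b using 3 by simp
      qed
    qed
    moreover have "1 / hw i j = r" by (simp add: hw_def r_def)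
    moreover have "0 < hw i j" using NS[of i j] ji by (auto simp: hw_def)
    ultimately show ?thesis using memA by simp
  qed
  have hc1: "hc i \<le> 1" for i using a by (simp add: hc_def)
  have hw1: "1 - hw i j \<le> N * \<tau>" "N * S j i - N\<^sup>2 * \<tau>\<^sup>2 \<le> 1 - hw i j" "hw i j \<le> 1" if "j \<noteq> i" for i j
  proof -
    define s where "s = N * S j i"
    have s: "0 \<le> s" "s \<le> N * \<tau>" using NS[of i j] S(2)[of j i] that N by (auto simp: s_def)
    have h: "1 - hw i j = s / (1 + s)" using s by (simp add: hw_def s_def[symmetric] field_simps)
    have "s / (1 + s) \<le> s" using s by (simp add: field_simps)
    then show "1 - hw i j \<le> N * \<tau>" using s h by linarith
    show "hw i j \<le> 1" using h s by (smt (verit) divide_nonneg_nonneg)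
    have "s - s\<^sup>2 \<le> s / (1 + s)"
    proof -
      have "(s - s\<^sup>2) * (1 + s) \<le> s" using s by (simp add: algebra_simps power2_eq_square)
      then show ?thesis using s by (simp add: le_divide_eq)
    qed
    moreover have "s\<^sup>2 \<le> (N * \<tau>)\<^sup>2" using s by (intro power_mono)
    ultimately show "N * S j i - N\<^sup>2 * \<tau>\<^sup>2 \<le> 1 - hw i j" using h by (simp add: s_def[symmetric] power_mult_distrib)
  qed
  have main: "hull_volume u * (1 + (\<Sum>i\<in>UNIV. 1 - hc i) / (real CARD('n) + 1)
      + (real CARD('n) - 1) / (real CARD('n) * (real CARD('n) + 1)) * (\<Sum>i\<in>UNIV. \<Sum>j\<in>UNIV - {i}. 1 - l i j)
      - (real CARD('n))\<^sup>2 * \<epsilon> * (2 * N * \<tau>)) \<le> measure lebesgue A"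
  proof (rule measure_ge_perturbed_simplex[where d = "\<lambda>k l. facet_normal l - facet_normal k" and hu = "\<lambda>_. 1" and hw = hw])
    show "(\<Sum>j\<in>UNIV. u j) = 0"
      unfolding u_def by (rule sum_std_vertex_minus_centroid)
    show "(facet_normal l - facet_normal k) \<bullet> u j = of_bool (j = k) - of_bool (j = l)" for k l j
      by (auto simp: u_def inner_diff_left facet_normal_inner bary_centroid bary_std_vertex)
    show "convex A" "bounded A" unfolding A_def
      using K by (auto simp: convex_translation_subtract bounded_translation_minus)
    show "0 \<in> A" by (rule memA, rule KT) (simp add: bary_centroid)
    show "(1 / 1) *\<^sub>R u j \<in> A" for j
      using K(3) by (auto simp: A_def u_def)
    show "0 < hc i" "(1 / hc i) *\<^sub>R ((- 1 / real CARD('n)) *\<^sub>R u i) \<in> A" for i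
      using hcA[of i] by (simp_all add: n_def)
    show "0 < hw i j" "(1 / hw i j) *\<^sub>R ((1 - \<epsilon>) *\<^sub>R u j - (\<epsilon> / real CARD('n)) *\<^sub>R u i) \<in> A" if "j \<noteq> i" for i j
      using hwA[OF that] by (simp_all add: n_def)
    show "hw i j = (1 - \<epsilon>) * l i j + \<epsilon> * hc i" if "j \<noteq> i" for i j
      using \<epsilon>' by (simp add: l_def)
    show "0 \<le> 2 * N * \<tau>" using N \<tau>0 by simp
    show "1 \<le> l i j + 2 * N * \<tau>" if "j \<noteq> i" for i j
    proof -
      have "1 - l i j = ((1 - hw i j) - \<epsilon> * (1 - hc i)) / (1 - \<epsilon>)"
        using \<epsilon>' by (simp add: l_def field_simps)
      also have "\<dots> \<le> (N * \<tau>) / (1 - \<epsilon>)"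
      proof (rule divide_right_mono)
        have "0 \<le> \<epsilon> * (1 - hc i)" using \<epsilon> hc1[of i] by simp
        then show "(1 - hw i j) - \<epsilon> * (1 - hc i) \<le> N * \<tau>" using hw1(1)[OF that] by linarith
      qed (use \<epsilon>' in simp)
      also have "\<dots> \<le> (N * \<tau>) / (1 / 2)"
        using \<epsilon>' N \<tau>0 by (intro divide_left_mono) auto
      finally show ?thesis by simp
    qed
  qed (use \<epsilon> \<epsilon>' in auto)
  have vol_u: "hull_volume u = 1 / fact CARD('n)"
    unfolding hull_volume_std_vertex[symmetric] hull_volume_det[of u] hull_volume_det[of std_vertex] by (simp add: u_def)
  have vol_A: "measure lebesgue A = measure lebesgue K"
    unfolding A_def by (rule measure_translation_subtract)
  define \<rho> where "\<rho> = 1 - hc m"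
  have \<rho>: "\<rho> = a / (1 + a)" using a by (simp add: \<rho>_def hc_def field_simps)
  have \<rho>t: "t / 3 \<le> \<rho>" "0 \<le> \<rho>"
  proof -
    have "t * a \<le> 1 * a" using a y by (intro mult_right_mono)
    then have "t / 3 * (1 + a) \<le> a" using a by (simp add: distrib_left)
    then show "t / 3 \<le> \<rho>" unfolding \<rho> using a by (simp add: le_divide_eq)
    then show "0 \<le> \<rho>" using y by simp
  qed
  have hcm: "1 - hc i = (if i = m then \<rho> else 0)" for i
    by (simp add: \<rho>_def hc_def)
  have sum_hc: "(\<Sum>i\<in>UNIV. 1 - hc i) = \<rho>"
    unfolding hcm by simp
  define \<Sigma> where "\<Sigma> = (\<Sum>i\<in>UNIV. \<Sum>j\<in>UNIV - {i}. S j i)"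
  have cd: "real (card (UNIV - {i :: 'n option})) = n" for i by (simp add: n_def card_Diff_subset)
  have sum_l: "(N * \<Sigma> - n * N * (N\<^sup>2 * \<tau>\<^sup>2) - \<epsilon> * n * \<rho>) / (1 - \<epsilon>) \<le> (\<Sum>i\<in>UNIV. \<Sum>j\<in>UNIV - {i}. 1 - l i j)"
  proof -
    have "(\<Sum>i\<in>UNIV. \<Sum>j\<in>UNIV - {i}. (N * S j i - N\<^sup>2 * \<tau>\<^sup>2 - \<epsilon> * (1 - hc i)) / (1 - \<epsilon>))
        \<le> (\<Sum>i\<in>UNIV. \<Sum>j\<in>UNIV - {i}. 1 - l i j)"
    proof (intro sum_mono)
      fix i j :: "'n option" assume "j \<in> UNIV - {i}"
      then have "j \<noteq> i" by simp
      have "1 - l i j = ((1 - hw i j) - \<epsilon> * (1 - hc i)) / (1 - \<epsilon>)"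
        using \<epsilon>' by (simp add: l_def field_simps)
      then show "(N * S j i - N\<^sup>2 * \<tau>\<^sup>2 - \<epsilon> * (1 - hc i)) / (1 - \<epsilon>) \<le> 1 - l i j"
        using hw1(2)[OF \<open>j \<noteq> i\<close>] \<epsilon>' by (simp add: divide_right_mono)
    qed
    moreover have "(\<Sum>i\<in>UNIV. \<Sum>j\<in>UNIV - {i}. (N * S j i - N\<^sup>2 * \<tau>\<^sup>2 - \<epsilon> * (1 - hc i)) / (1 - \<epsilon>))
      = (\<Sum>i\<in>UNIV. \<Sum>j\<in>UNIV - {i}. N * S j i - N\<^sup>2 * \<tau>\<^sup>2 - \<epsilon> * (1 - hc i)) / (1 - \<epsilon>)"
      by (simp add: sum_divide_distrib)
    moreover have "(\<Sum>i\<in>UNIV. \<Sum>j\<in>UNIV - {i}. N * S j i - N\<^sup>2 * \<tau>\<^sup>2 - \<epsilon> * (1 - hc i))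
       = (\<Sum>i\<in>UNIV. N * (\<Sum>j\<in>UNIV - {i}. S j i) - n * (N\<^sup>2 * \<tau>\<^sup>2) - n * (\<epsilon> * (1 - hc i)))"
      by (simp only: sum_subtractf sum_constant cd sum_distrib_left)
    moreover have "\<dots> = N * \<Sigma> - n * N * (N\<^sup>2 * \<tau>\<^sup>2) - \<epsilon> * n * \<rho>"
    proof -
      have e1: "(\<Sum>i\<in>UNIV. n * (\<epsilon> * (1 - hc i))) = n * (\<epsilon> * (\<Sum>i\<in>UNIV. 1 - hc i))"
        by (simp only: sum_distrib_left)
      have e2: "(\<Sum>i\<in>(UNIV :: 'n option set). n * (N\<^sup>2 * \<tau>\<^sup>2)) = N * (n * (N\<^sup>2 * \<tau>\<^sup>2))"
        by (simp only: sum_constant card_UNIV_option_real[where 'n='n] N_def)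
      have e3: "(\<Sum>i\<in>UNIV. N * (\<Sum>j\<in>UNIV - {i}. S j i)) = N * \<Sigma>"
        unfolding \<Sigma>_def by (simp only: sum_distrib_left)
      show ?thesis
        unfolding sum_subtractf[of "\<lambda>i. N * (\<Sum>j\<in>UNIV - {i}. S j i) - n * (N\<^sup>2 * \<tau>\<^sup>2)"]
          sum_subtractf[of "\<lambda>i. N * (\<Sum>j\<in>UNIV - {i}. S j i)"] e1 e2 e3 sum_hc
        by (simp add: mult_ac)
    qed
    ultimately show ?thesis by simp
  qed
  have "1 + (n - 1) / (n * (1 - \<epsilon>)) * \<Sigma> + t / (6 * N) - 2 * n * N\<^sup>2 * \<tau>\<^sup>2 - 2 * n\<^sup>2 * N * \<epsilon> * \<tau>
      \<le> 1 + \<rho> / N + (n - 1) / (n * N) * ((N * \<Sigma> - n * N * (N\<^sup>2 * \<tau>\<^sup>2) - \<epsilon> * n * \<rho>) / (1 - \<epsilon>)) - n\<^sup>2 * \<epsilon> * (2 * N * \<tau>)"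
  proof -
    have "(n - 1) / (n * N) * ((N * \<Sigma> - n * N * (N\<^sup>2 * \<tau>\<^sup>2) - \<epsilon> * n * \<rho>) / (1 - \<epsilon>))
       = (n - 1) / (n * (1 - \<epsilon>)) * \<Sigma> - (n - 1) / (1 - \<epsilon>) * (N\<^sup>2 * \<tau>\<^sup>2) - (n - 1) / (1 - \<epsilon>) * \<epsilon> * (\<rho> / N)"
      using n1 N(2) \<epsilon>'(2) by (simp add: divide_simps) (simp add: algebra_simps)
    moreover have c: "(n - 1) / (1 - \<epsilon>) \<le> 2 * n"
    proof -
      have "n * (1 / 2) \<le> n * (1 - \<epsilon>)" using n1 \<epsilon>' by (intro mult_left_mono) auto
      then have "n - 1 \<le> 2 * n * (1 - \<epsilon>)" by simp
      then show ?thesis using \<epsilon>' by (simp add: divide_le_eq)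
    qed
    moreover have "(n - 1) / (1 - \<epsilon>) * (N\<^sup>2 * \<tau>\<^sup>2) \<le> 2 * n * (N\<^sup>2 * \<tau>\<^sup>2)"
      using c by (intro mult_right_mono) auto
    moreover have "(n - 1) / (1 - \<epsilon>) * \<epsilon> * (\<rho> / N) \<le> 1 / 2 * (\<rho> / N)"
    proof (rule mult_right_mono)
      have "(n - 1) / (1 - \<epsilon>) * \<epsilon> \<le> 2 * n * \<epsilon>" using c \<epsilon>(1) by (intro mult_right_mono) auto
      also have "\<dots> \<le> 1 / 2" using \<epsilon>(2) unfolding mult.assoc by linarith
      finally show "(n - 1) / (1 - \<epsilon>) * \<epsilon> \<le> 1 / 2" .
    qed (use \<rho>t N in auto)
    moreover have "t / (6 * N) \<le> 1 / 2 * (\<rho> / N)"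
    proof -
      have "(t / 6) / N \<le> (\<rho> / 2) / N" using \<rho>t N by (intro divide_right_mono) auto
      then show ?thesis by simp
    qed
    ultimately show ?thesis by (simp add: mult.assoc)
  qed
  also have "\<dots> \<le> 1 + \<rho> / N + (n - 1) / (n * N) * (\<Sum>i\<in>UNIV. \<Sum>j\<in>UNIV - {i}. 1 - l i j) - n\<^sup>2 * \<epsilon> * (2 * N * \<tau>)"
    using mult_left_mono[OF sum_l, of "(n - 1) / (n * N)"] n1 N by simp
  also have "\<dots> \<le> fact CARD('n) * measure lebesgue K"
  proof -
    have "X \<le> f * M" if "1 / f * X \<le> M" "0 < f" for X f M :: real
      using that by (simp add: field_simps)
    from this[OF main[unfolded vol_u vol_A sum_hc n_def[symmetric], folded N(1)]] show ?thesis by simp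
  qed
  finally show ?thesis unfolding \<Sigma>_def .
qed

section \<open>Its polar bodies\<close>

lemma sum_facet_normal: "(\<Sum>k\<in>UNIV. facet_normal k) = (0 :: real^'n::finite)"
  by (simp add: sum_UNIV_option facet_normal_def sum_negf vec_eq_iff axis_def if_distrib cong: if_cong)

lemma facet_normal_inner_std_vertex: "facet_normal k \<bullet> (std_vertex i - std_vertex j) = of_bool (k = j) - of_bool (k = i)"
  for i :: "'n::finite option"
  by (simp add: facet_normal_inner bary_std_vertex)

text \<open>These vectors are the vertices of the polar body of the standard simplex about its centroid.\<close>
lemma hull_volume_scaled_facet_normal:
  "hull_volume (\<lambda>k. (real CARD('n) + 1) *\<^sub>R facet_normal k :: real^'n) = (real CARD('n) + 1) ^ (CARD('n) + 1) / fact CARD('n::finite)"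
proof -
  let ?N = "real CARD('n) + 1"
  define u :: "'n option \<Rightarrow> real^'n" where "u = (\<lambda>k. ?N *\<^sub>R facet_normal k)"
  define P where "P = u(None := 0)"
  have "(\<chi> i. P (Some i) - P None) = (\<chi> i j. if i = j then - ?N else 0)"
    by (auto simp: P_def u_def facet_normal_def vec_eq_iff axis_def)
  then have "det (\<chi> i. P (Some i) - P None) = (\<Prod>i\<in>(UNIV :: 'n set). - ?N)"
    by (simp add: det_diagonal)
  then have VP: "hull_volume P = ?N ^ CARD('n) / fact CARD('n)"
    unfolding hull_volume_det by (simp add: power_abs add.commute)
  let ?\<mu> = "\<lambda>k :: 'n option. case k of None \<Rightarrow> ?N | Some i \<Rightarrow> (- 1 :: real)"
  have 1: "(\<Sum>k\<in>UNIV. ?\<mu> k) = 1"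
    by (simp add: sum_UNIV_option)
  have "(\<Sum>k\<in>UNIV. u k) = 0"
    unfolding u_def scaleR_sum_right[symmetric] sum_facet_normal by simp
  then have "u None = (\<Sum>k\<in>UNIV. ?\<mu> k *\<^sub>R P k)"
    by (simp add: sum_UNIV_option P_def sum_negf eq_neg_iff_add_eq_0)
  then have "hull_volume (P(None := u None)) = ?N * hull_volume P"
    using hull_volume_replace[OF 1, of "u None" P None] by simp
  moreover have "P(None := u None) = u" by (simp add: P_def)
  ultimately show ?thesis using VP by (simp add: u_def)
qed

lemma convex_polar_body: "convex (polar_body K z)"
proof -
  have "polar_body K z = (\<Inter>x\<in>K. {y. (x - z) \<bullet> y \<le> 1})"
    by (auto simp: polar_body_def inner_commute)
  then show ?thesis by (simp add: convex_INT convex_halfspace_le)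
qed

lemma bounded_polar_body:
  assumes "z \<in> interior K"
  shows "bounded (polar_body K z)"
proof -
  obtain r where r: "0 < r" "cball z r \<subseteq> K"
    using assms by (meson mem_interior_cball)
  show ?thesis
    unfolding bounded_iff
  proof (intro exI ballI)
    fix y assume y: "y \<in> polar_body K z"
    show "norm y \<le> 1 / r"
    proof (cases "y = 0")
      case False
      have "z + (r / norm y) *\<^sub>R y \<in> cball z r"
        using r False by (simp add: dist_norm)
      then have "y \<bullet> (z + (r / norm y) *\<^sub>R y - z) \<le> 1"
        using y r(2) unfolding polar_body_def by blast
      then have "r * norm y \<le> 1"
        using False by (simp add: power2_norm_eq_inner[symmetric] power2_eq_square)
      then show ?thesis using r by (simp add: field_simps)
    qed (use r in simp)
  qed
qed

text \<open>Positivity of \<open>h\<close> comes for free: a nonzero functional takes positive values near an interior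
  point.\<close>
lemma scaled_in_polar_body:
  assumes z: "z \<in> interior K" and y: "y \<noteq> 0" and h: "\<And>x. x \<in> K \<Longrightarrow> y \<bullet> (x - z) \<le> h"
  shows "0 < h \<and> (1 / h) *\<^sub>R y \<in> polar_body K z"
proof
  obtain r where r: "0 < r" "cball z r \<subseteq> K"
    using z by (meson mem_interior_cball)
  have "z + (r / norm y) *\<^sub>R y \<in> cball z r"
    using r y by (simp add: dist_norm)
  then have "y \<bullet> (z + (r / norm y) *\<^sub>R y - z) \<le> h"
    using h r by blast
  moreover have "y \<bullet> (z + (r / norm y) *\<^sub>R y - z) = r * norm y"
    using y by (simp add: power2_norm_eq_inner[symmetric] power2_eq_square)
  moreover have "0 < r * norm y" using r y by simp
  ultimately show "0 < h" by linarith
  then show "(1 / h) *\<^sub>R y \<in> polar_body K z"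
    using h by (simp add: polar_body_def divide_le_eq)
qed

text \<open>Volume of the polar body. Since the coordinate \<open>bary i\<close> is at most \<open>1\<close> on \<open>K\<close>, no loss occurs at the facet centroids.
  The coordinates \<open>\<beta>\<close> of the centre \<open>z\<close> enter all support values linearly, and their
  contributions to \<open>sum_hc\<close> and \<open>sum_l\<close> are constant because they add up to \<open>1\<close>.\<close>
lemma measure_polar_ge_inscribed:
  fixes K :: "(real^'n::finite) set" and S :: "'n option \<Rightarrow> 'n option \<Rightarrow> real"
  defines "n \<equiv> real CARD('n)" and "N \<equiv> real CARD('n) + 1"
  assumes z: "z \<in> interior K"
    and b1: "\<And>k x. x \<in> K \<Longrightarrow> bary k x \<le> 1" and b\<tau>: "\<And>k x. x \<in> K \<Longrightarrow> - \<tau> \<le> bary k x"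
    and \<epsilon>: "0 < \<epsilon>" "\<epsilon> < 1" and \<tau>: "0 \<le> \<tau>"
    and S: "\<And>i j. i \<noteq> j \<Longrightarrow> 0 \<le> S i j"
      "\<And>i j x. i \<noteq> j \<Longrightarrow> x \<in> K \<Longrightarrow> vertex_functional \<epsilon> i j x \<le> \<epsilon> / n + S i j"
  shows "N ^ (CARD('n) + 1) / fact CARD('n)
      * (1 - (n - 1) / (n * (1 - \<epsilon>)) * (\<Sum>i\<in>UNIV. \<Sum>j\<in>UNIV - {i}. S i j) - n\<^sup>2 * N * \<epsilon> * \<tau>)
    \<le> measure lebesgue (polar_body K z)"
proof -
  have n1: "1 \<le> n" unfolding n_def by (simp add: Suc_leI)
  have N: "N = n + 1" "N \<ge> 2" using n1 by (simp_all add: N_def n_def)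
  define \<beta> where "\<beta> k = bary k z" for k
  define u :: "'n option \<Rightarrow> real^'n" where "u = (\<lambda>k. N *\<^sub>R facet_normal k)"
  have u: "u k \<bullet> (x - z) = N * (\<beta> k - bary k x)" for k x
    by (simp add: u_def facet_normal_inner \<beta>_def)
  have uv: "u k \<bullet> (std_vertex i - std_vertex j) = N * (of_bool (k = j) - of_bool (k = i))" for k i j
    by (simp add: u_def facet_normal_inner_std_vertex)
  have u_ne: "a *\<^sub>R u j - b *\<^sub>R u i \<noteq> 0" if "i \<noteq> j" "0 < a \<or> 0 < b" "0 \<le> a" "0 \<le> b" for a b i j
  proof
    assume "a *\<^sub>R u j - b *\<^sub>R u i = 0"
    then have "(a *\<^sub>R u j - b *\<^sub>R u i) \<bullet> (std_vertex i - std_vertex j) = 0" by simp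
    then have "N * (a + b) = 0"
      unfolding inner_diff_left inner_scaleR_left uv using that(1) by (simp add: distrib_left mult.commute)
    then show False using that N by auto
  qed
  have other: "\<exists>j. j \<noteq> i" for i :: "'n option"
    by (cases i) auto
  define hc where "hc i = N * (1 - \<beta> i) / n" for i
  define hw where "hw i j = N * ((1 - \<epsilon>) * \<beta> j - \<epsilon> * \<beta> i / n + \<epsilon> / n + S i j)" for i j
  define hu where "hu j = N * (\<beta> j + \<tau>)" for j
  define l where "l i j = N * (\<beta> j + S i j / (1 - \<epsilon>))" for i j
  have hc: "0 < hc i \<and> (1 / hc i) *\<^sub>R ((- 1 / n) *\<^sub>R u i) \<in> polar_body K z" for i
  proof (rule scaled_in_polar_body[OF z])
    obtain j where "j \<noteq> i" using other by blast
    then show "(- 1 / n) *\<^sub>R u i \<noteq> 0" using u_ne[of i j 0 "1 / n"] n1 by simp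
    fix x assume "x \<in> K"
    then have "N * (bary i x - \<beta> i) / n \<le> N * (1 - \<beta> i) / n"
      using b1[of x i] N n1 by (intro divide_right_mono mult_left_mono) auto
    moreover have "((- 1 / n) *\<^sub>R u i) \<bullet> (x - z) = N * (bary i x - \<beta> i) / n"
      unfolding inner_scaleR_left u using n1 by (simp add: field_simps)
    ultimately show "((- 1 / n) *\<^sub>R u i) \<bullet> (x - z) \<le> hc i" unfolding hc_def by simp
  qed
  have hu: "0 < hu j \<and> (1 / hu j) *\<^sub>R u j \<in> polar_body K z" for j
  proof (rule scaled_in_polar_body[OF z])
    obtain i where "i \<noteq> j" using other by blast
    then show "u j \<noteq> 0" using u_ne[of i j 1 0] by simp
    fix x assume "x \<in> K"
    then show "u j \<bullet> (x - z) \<le> hu j"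
      unfolding u hu_def using b\<tau>[of x j] N by (intro mult_left_mono) auto
  qed
  have hw: "0 < hw i j \<and> (1 / hw i j) *\<^sub>R ((1 - \<epsilon>) *\<^sub>R u j - (\<epsilon> / n) *\<^sub>R u i) \<in> polar_body K z" if ji: "j \<noteq> i" for i j
  proof (rule scaled_in_polar_body[OF z])
    show "(1 - \<epsilon>) *\<^sub>R u j - (\<epsilon> / n) *\<^sub>R u i \<noteq> 0"
      using ji \<epsilon> n1 by (intro u_ne) auto
    fix x assume x: "x \<in> K"
    have "((1 - \<epsilon>) *\<^sub>R u j - (\<epsilon> / n) *\<^sub>R u i) \<bullet> (x - z)
        = N * ((1 - \<epsilon>) * \<beta> j - \<epsilon> * \<beta> i / n + vertex_functional \<epsilon> i j x)"
      unfolding inner_diff_left inner_scaleR_left u vertex_functional_def n_def[symmetric]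
      by (simp add: algebra_simps)
    also have "\<dots> \<le> hw i j"
      unfolding hw_def using S(2)[of i j x] ji x N by (intro mult_left_mono) auto
    finally show "((1 - \<epsilon>) *\<^sub>R u j - (\<epsilon> / n) *\<^sub>R u i) \<bullet> (x - z) \<le> hw i j" .
  qed
  have main: "hull_volume u * (1 + (\<Sum>i\<in>UNIV. 1 - hc i) / (real CARD('n) + 1)
      + (real CARD('n) - 1) / (real CARD('n) * (real CARD('n) + 1)) * (\<Sum>i\<in>UNIV. \<Sum>j\<in>UNIV - {i}. 1 - l i j)
      - (real CARD('n))\<^sup>2 * \<epsilon> * (N * \<tau>)) \<le> measure lebesgue (polar_body K z)"
  proof (rule measure_ge_perturbed_simplex[where d = "\<lambda>k l. (1 / N) *\<^sub>R (std_vertex l - std_vertex k)" and hu = hu and hw = hw])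
    show "(\<Sum>j\<in>UNIV. u j) = 0"
      unfolding u_def scaleR_sum_right[symmetric] sum_facet_normal by simp
    show "((1 / N) *\<^sub>R (std_vertex l - std_vertex k)) \<bullet> u j = of_bool (j = k) - of_bool (j = l)" for k l j
      using N by (simp add: inner_commute[of _ "u j"] uv)
    show "convex (polar_body K z)" by (rule convex_polar_body)
    show "bounded (polar_body K z)" by (rule bounded_polar_body[OF z])
    show "0 \<in> polar_body K z" by (simp add: polar_body_def)
    show "0 < hc i" "(1 / hc i) *\<^sub>R ((- 1 / real CARD('n)) *\<^sub>R u i) \<in> polar_body K z" for i
      using hc[of i] unfolding n_def by auto
    show "0 < hw i j" "(1 / hw i j) *\<^sub>R ((1 - \<epsilon>) *\<^sub>R u j - (\<epsilon> / real CARD('n)) *\<^sub>R u i) \<in> polar_body K z" if "j \<noteq> i" for i j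
      using hw[OF that] unfolding n_def by auto
    show "0 < hu j" "(1 / hu j) *\<^sub>R u j \<in> polar_body K z" for j
      using hu[of j] by auto
    show "hw i j = (1 - \<epsilon>) * l i j + \<epsilon> * hc i" if "j \<noteq> i" for i j
    proof -
      have "(1 - \<epsilon>) * l i j = N * ((1 - \<epsilon>) * \<beta> j + S i j)"
        using \<epsilon> by (simp add: l_def distrib_left)
      moreover have "\<epsilon> * hc i = N * (\<epsilon> / n - \<epsilon> * \<beta> i / n)"
        using n1 by (simp add: hc_def field_simps)
      ultimately show ?thesis by (simp add: hw_def algebra_simps)
    qed
    show "0 \<le> N * \<tau>" using N \<tau> by simp
    show "hu j \<le> l i j + N * \<tau>" if "j \<noteq> i" for i j
    proof -
      have "0 \<le> N * (S i j / (1 - \<epsilon>))" using S(1)[of i j] that \<epsilon> N by simp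
      then show ?thesis by (simp add: hu_def l_def distrib_left)
    qed
  qed (use \<epsilon> in auto)
  have vol_u: "hull_volume u = N ^ (CARD('n) + 1) / fact CARD('n)"
    unfolding u_def N_def by (rule hull_volume_scaled_facet_normal)
  have sum\<beta>: "(\<Sum>i\<in>UNIV. \<beta> i) = 1" by (simp add: \<beta>_def)
  have cN: "(\<Sum>i\<in>(UNIV :: 'n option set). c) = N * c" for c :: real
    by (simp only: sum_constant card_UNIV_option_real N_def)
  have cn: "(\<Sum>j\<in>UNIV - {i :: 'n option}. c) = n * c" for c :: real and i
    by (simp add: n_def card_Diff_subset)
  have sum_hc: "(\<Sum>i\<in>UNIV. 1 - hc i) = 0"
  proof -
    have "(\<Sum>i\<in>UNIV. hc i) = N / n * (\<Sum>i\<in>UNIV. 1 - \<beta> i)"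
      unfolding hc_def sum_distrib_left by simp
    also have "(\<Sum>i\<in>UNIV. 1 - \<beta> i) = n"
      by (simp only: sum_subtractf cN sum\<beta> N(1)) simp
    finally show ?thesis
      using n1 by (simp only: sum_subtractf cN) simp
  qed
  define \<Sigma> where "\<Sigma> = (\<Sum>i\<in>UNIV. \<Sum>j\<in>UNIV - {i}. S i j)"
  have sum_l: "(\<Sum>i\<in>UNIV. \<Sum>j\<in>UNIV - {i}. 1 - l i j) = - (N * \<Sigma> / (1 - \<epsilon>))"
  proof -
    have s: "(\<Sum>j\<in>UNIV - {i}. \<beta> j) = 1 - \<beta> i" for i
      using sum\<beta> by (simp add: sum_diff1)
    have "(\<Sum>j\<in>UNIV - {i}. l i j) = N * ((1 - \<beta> i) + (\<Sum>j\<in>UNIV - {i}. S i j) / (1 - \<epsilon>))" for i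
      unfolding l_def sum_distrib_left[symmetric] sum.distrib sum_divide_distrib[symmetric] s ..
    then have "(\<Sum>j\<in>UNIV - {i}. 1 - l i j) = n - N * (1 - \<beta> i) - N / (1 - \<epsilon>) * (\<Sum>j\<in>UNIV - {i}. S i j)" for i
      by (simp add: sum_subtractf distrib_left n_def)
    then have "(\<Sum>i\<in>UNIV. \<Sum>j\<in>UNIV - {i}. 1 - l i j)
      = (\<Sum>i\<in>UNIV. n - N * (1 - \<beta> i) - N / (1 - \<epsilon>) * (\<Sum>j\<in>UNIV - {i}. S i j))" by simp
    also have "\<dots> = N * n - N * (N * 1 - 1) - N / (1 - \<epsilon>) * \<Sigma>"
      by (simp only: sum_subtractf sum_distrib_left[symmetric] cN sum\<beta> \<Sigma>_def)
    finally show ?thesis by (simp add: N(1))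
  qed
  have "(n - 1) / (n * N) * - (N * \<Sigma> / (1 - \<epsilon>)) = - ((n - 1) / (n * (1 - \<epsilon>)) * \<Sigma>)"
    using N(2) by simp
  then have "1 + 0 / N + (n - 1) / (n * N) * - (N * \<Sigma> / (1 - \<epsilon>)) - n\<^sup>2 * \<epsilon> * (N * \<tau>)
      = 1 - (n - 1) / (n * (1 - \<epsilon>)) * \<Sigma> - n\<^sup>2 * N * \<epsilon> * \<tau>"
    by simp
  with main show ?thesis
    unfolding vol_u sum_hc sum_l n_def[symmetric] N(1)[symmetric] \<Sigma>_def[symmetric] by metis
qed

section \<open>Affine invariance of the volume product\<close>

lemma affine_isomorphism_comp:
  assumes "affine_isomorphism A" "affine_isomorphism B"
  shows "affine_isomorphism (\<lambda>x. A (B x))"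
proof -
  obtain f b g c where f: "linear f" "bij f" "A = (\<lambda>x. f x + b)" and g: "linear g" "bij g" "B = (\<lambda>x. g x + c)"
    using assms unfolding affine_isomorphism_def by blast
  have "linear (f \<circ> g)" "bij (f \<circ> g)"
    using f g by (auto intro: linear_compose bij_comp)
  moreover have "(\<lambda>x. A (B x)) = (\<lambda>x. (f \<circ> g) x + (f c + b))"
    using f g by (simp add: linear_add add.assoc)
  ultimately show ?thesis
    unfolding affine_isomorphism_def by blast
qed

lemma affine_isomorphism_bij: "affine_isomorphism A \<Longrightarrow> bij A"
proof -
  assume "affine_isomorphism A"
  then obtain f b where f: "linear f" "bij f" "A = (\<lambda>x. f x + b)"
    unfolding affine_isomorphism_def by blast
  have "A = (\<lambda>x. x + b) \<circ> f" using f by auto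
  then show "bij A" using bij_comp[OF f(2) bij_plus_right[of b]] by simp
qed

lemma affine_isomorphism_inv:
  fixes A :: "'a::euclidean_space \<Rightarrow> 'a"
  assumes "affine_isomorphism A"
  shows "affine_isomorphism (inv A)"
proof -
  obtain f b where f: "linear f" "bij f" "A = (\<lambda>x. f x + b)"
    using assms unfolding affine_isomorphism_def by blast
  have lin: "linear (inv f)" using f by (simp add: inj_linear_imp_inv_linear bij_is_inj)
  have "inv A = (\<lambda>y. inv f y + - inv f b)"
  proof (rule inv_equality)
    show "inv f (A x) + - inv f b = x" for x
      using f lin by (simp add: linear_add bij_is_inj)
    show "A (inv f y + - inv f b) = y" for y
      using f by (simp add: linear_add linear_diff bij_is_surj surj_f_inv_f)
  qed
  then show ?thesis
    using lin bij_imp_bij_inv[OF f(2)] unfolding affine_isomorphism_def by blast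
qed

lemma affine_isomorphism_translation: "affine_isomorphism (\<lambda>x. x - a)"
  unfolding affine_isomorphism_def
  by (intro exI[of _ "\<lambda>x. x"] exI[of _ "- a"]) (auto simp: linear_iff bij_def)

lemma affine_isomorphism_measure:
  fixes A :: "real^'n \<Rightarrow> real^'n"
  assumes "affine_isomorphism A"
  obtains d where "0 < d" "\<And>X. X \<in> lmeasurable \<Longrightarrow> A ` X \<in> lmeasurable"
    "\<And>X. X \<in> lmeasurable \<Longrightarrow> measure lebesgue (A ` X) = d * measure lebesgue X"
proof -
  obtain f b where f: "linear f" "bij f" "A = (\<lambda>x. f x + b)"
    using assms unfolding affine_isomorphism_def by blast
  have im: "A ` X = (+) b ` f ` X" for X
    unfolding f(3) image_image by (simp add: add.commute)
  show thesis
  proof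
    show "0 < \<bar>det (matrix f)\<bar>"
      using f det_nz_iff_inj[OF f(1)] by (simp add: bij_is_inj)
    show "A ` X \<in> lmeasurable" "measure lebesgue (A ` X) = \<bar>det (matrix f)\<bar> * measure lebesgue X"
      if "X \<in> lmeasurable" for X
      unfolding im using measure_lebesgue_linear_image[OF f(1) that]
      by (simp_all add: measurable_translation measure_translation)
  qed
qed

lemma affine_isomorphism_convex_hull:
  assumes "affine_isomorphism A"
  shows "convex hull (A ` X) = A ` (convex hull X)"
proof -
  obtain f b where f: "linear f" "bij f" "A = (\<lambda>x. f x + b)"
    using assms unfolding affine_isomorphism_def by blast
  have im: "A ` X = (+) b ` f ` X" for X
    unfolding f(3) image_image by (simp add: add.commute)
  show ?thesis
    unfolding im convex_hull_translation convex_hull_linear_image[OF f(1)] ..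
qed

lemma hull_volume_affine_image:
  assumes d: "\<And>X. X \<in> lmeasurable \<Longrightarrow> measure lebesgue (A ` X) = d * measure lebesgue X"
    and A: "affine_isomorphism A"
  shows "hull_volume (\<lambda>k. A (P k)) = d * hull_volume P"
proof -
  have "range (\<lambda>k. A (P k)) = A ` range P" by auto
  then show ?thesis
    unfolding hull_volume_def using d[OF lmeasurable_hull_range[of P]]
    by (simp add: affine_isomorphism_convex_hull[OF A])
qed

lemma affine_isomorphism_interior:
  fixes A :: "'a::euclidean_space \<Rightarrow> 'a"
  assumes "affine_isomorphism A"
  shows "interior (A ` K) = A ` interior K"
proof -
  obtain f b where f: "linear f" "bij f" "A = (\<lambda>x. f x + b)"
    using assms unfolding affine_isomorphism_def by blast
  have im: "A ` X = (+) b ` f ` X" for X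
    unfolding f(3) image_image by (simp add: add.commute)
  show ?thesis
    unfolding im interior_translation using interior_injective_linear_image[OF f(1)] f(2) by (simp add: bij_is_inj)
qed

lemma lmeasurable_polar_body: "z \<in> interior K \<Longrightarrow> polar_body K z \<in> lmeasurable"
  by (intro measurable_convex convex_polar_body bounded_polar_body)

text \<open>The polar of the image is the image of the polar under the inverse adjoint, which has the inverse
  determinant.\<close>
lemma volume_product_affine_image:
  fixes K :: "(real^'n) set"
  assumes A: "affine_isomorphism A" and K: "K \<in> lmeasurable"
  shows "volume_product (A ` K) = volume_product K"
proof -
  obtain f b where f: "linear f" "bij f" "A = (\<lambda>x. f x + b)"
    using A unfolding affine_isomorphism_def by blast
  define d where "d = \<bar>det (matrix f)\<bar>"
  have d0: "d \<noteq> 0"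
    using f det_nz_iff_inj[OF f(1)] by (simp add: d_def bij_is_inj)
  have im: "A ` X = (+) b ` f ` X" for X
    unfolding f(3) image_image by (simp add: add.commute)
  have vol: "measure lebesgue (A ` K) = d * measure lebesgue K"
    unfolding im d_def using measure_lebesgue_linear_image[OF f(1) K] by (simp add: measure_translation)
  have "measure lebesgue (A ` K) * measure lebesgue (polar_body (A ` K) (A z))
      = measure lebesgue K * measure lebesgue (polar_body K z)" if z: "z \<in> interior K" for z
  proof -
    have "polar_body K z = adjoint f ` polar_body (A ` K) (A z)"
    proof -
      have iff: "y \<in> polar_body (A ` K) (A z) \<longleftrightarrow> adjoint f y \<in> polar_body K z" for y
        unfolding polar_body_def f(3)
        by (simp add: linear_diff[OF f(1), symmetric] adjoint_works[OF f(1)] inner_commute)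
      have "surj (adjoint f)" using f by (simp add: bij_is_inj)
      show ?thesis
      proof (intro subset_antisym subsetI)
        fix x assume x: "x \<in> polar_body K z"
        obtain y where "x = adjoint f y" using \<open>surj (adjoint f)\<close> by (rule surjE)
        then show "x \<in> adjoint f ` polar_body (A ` K) (A z)" using iff x by blast
      qed (use iff in blast)
    qed
    moreover have "A z \<in> interior (A ` K)"
      using z by (simp add: affine_isomorphism_interior[OF A])
    ultimately have "measure lebesgue (polar_body K z) = \<bar>det (matrix (adjoint f))\<bar> * measure lebesgue (polar_body (A ` K) (A z))"
      using measure_lebesgue_linear_image[OF adjoint_linear[OF f(1)] lmeasurable_polar_body] by simp
    also have "\<bar>det (matrix (adjoint f))\<bar> = d"
      using matrix_adjoint[OF f(1)] by (simp add: d_def)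
    finally show ?thesis using vol by simp
  qed
  then show ?thesis
    unfolding volume_product_def affine_isomorphism_interior[OF A] image_image
    by (intro arg_cong[of _ _ Inf] image_cong) simp_all
qed

lemma affine_isomorphism_simplex_map:
  fixes P :: "'n::finite option \<Rightarrow> real^'n"
  assumes "hull_volume P \<noteq> 0"
  shows "affine_isomorphism (simplex_map P)"
proof -
  define L where "L \<equiv> \<lambda>x::real^'n. \<Sum>i\<in>UNIV. x $ i *\<^sub>R (P (Some i) - P None)"
  note L = simplex_map_linear[of P, folded L_def]
  have "det (matrix L) \<noteq> 0"
    using assms unfolding hull_volume_det L(3) by simp
  then have "inj L" using det_nz_iff_inj[OF L(1)] by simp
  then have "bij L" using L(1) by (simp add: bij_def linear_injective_imp_surjective)
  moreover have "simplex_map P = (\<lambda>x. L x + P None)" using L(2) by (simp add: fun_eq_iff add.commute L_def)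
  ultimately show ?thesis using L(1) unfolding affine_isomorphism_def by blast
qed

text \<open>Affine independence of the vertices is exactly injectivity of the linear part of the
  barycentric map.\<close>
lemma simplex_is_affine_image:
  fixes S :: "(real^'n::finite) set"
  assumes "int CARD('n) simplex S"
  shows "\<exists>A. affine_isomorphism A \<and> S = A ` (convex hull (range std_vertex))"
proof -
  obtain C where C: "\<not> affine_dependent C" "int (card C) = int CARD('n) + 1" "S = convex hull C"
    using assms unfolding simplex_def by blast
  have "card C = CARD('n option)" using C(2) by (simp add: UNIV_option_conv card_image)
  moreover have fin: "finite C" using C(1) by (rule aff_independent_finite)
  ultimately obtain P :: "'n option \<Rightarrow> real^'n" where P: "bij_betw P UNIV C"
    by (metis finite_same_card_bij finite_UNIV_fun finite_class.finite_UNIV)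
  define L where "L \<equiv> \<lambda>x::real^'n. \<Sum>i\<in>UNIV. x $ i *\<^sub>R (P (Some i) - P None)"
  note L = simplex_map_linear[of P, folded L_def]
  have "inj L"
    unfolding linear_injective_0[OF L(1)]
  proof (intro allI impI)
    fix x assume 0: "L x = 0"
    define c where "c k = (case k of None \<Rightarrow> - (\<Sum>i\<in>UNIV. x $ i) | Some i \<Rightarrow> x $ i)" for k
    define U where "U v = c (inv_into UNIV P v)" for v
    have UP: "U (P k) = c k" for k
      using P by (simp add: U_def bij_betw_def inv_into_f_f)
    have "sum U C = (\<Sum>k\<in>UNIV. c k)"
      using sum.reindex_bij_betw[OF P, of U] UP by simp
    also have "\<dots> = 0" by (simp add: sum_UNIV_option c_def)
    finally have 1: "sum U C = 0" .
    have "(\<Sum>v\<in>C. U v *\<^sub>R v) = (\<Sum>k\<in>UNIV. c k *\<^sub>R P k)"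
      using sum.reindex_bij_betw[OF P, of "\<lambda>v. U v *\<^sub>R v"] UP by simp
    also have "\<dots> = L x"
      by (simp add: sum_UNIV_option c_def L_def scaleR_diff_right sum_subtractf scaleR_sum_left)
    finally have 2: "(\<Sum>v\<in>C. U v *\<^sub>R v) = 0" using 0 by simp
    have "U v = 0" if "v \<in> C" for v
      using C(1) 1 2 that unfolding affine_dependent_explicit_finite[OF fin] by blast
    moreover have "P (Some i) \<in> C" for i using P by (auto simp: bij_betw_def)
    ultimately have "c (Some i) = 0" for i using UP by metis
    then show "x = 0" by (simp add: c_def vec_eq_iff)
  qed
  then have "bij L" using L(1) by (simp add: bij_def linear_injective_imp_surjective)
  moreover have "simplex_map P = (\<lambda>x. L x + P None)" using L(2) by (simp add: fun_eq_iff add.commute L_def)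
  ultimately have "affine_isomorphism (simplex_map P)" using L(1) unfolding affine_isomorphism_def by blast
  moreover have "S = simplex_map P ` (convex hull (range std_vertex))"
    using P C(3) by (simp add: simplex_map_image bij_betw_def)
  ultimately show ?thesis by blast
qed

lemma continuous_on_bary: "continuous_on X (bary k)"
proof (cases k)
  case None
  have "continuous_on X (\<lambda>x. 1 - (\<Sum>i\<in>UNIV. x $ i))" by (intro continuous_intros)
  then show ?thesis using None by (simp add: bary_def[abs_def])
next
  case (Some i)
  have "continuous_on X (\<lambda>x. x $ i)" by (intro continuous_intros)
  then show ?thesis using Some by (simp add: bary_def[abs_def])
qed

lemma centroid_in_interior: "centroid \<in> interior (convex hull (range std_vertex))"
proof (rule interiorI)
  show "open (\<Inter>k. {x. 0 < bary k x})"
    by (intro open_INT ballI open_Collect_less continuous_on_bary continuous_intros) simp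
  show "centroid \<in> (\<Inter>k. {x. 0 < bary k x})"
    by (simp add: bary_centroid add_pos_nonneg)
  show "(\<Inter>k. {x. 0 < bary k x}) \<subseteq> convex hull (range std_vertex)"
    unfolding std_simplex_eq by (auto intro: less_imp_le)
qed

lemma volume_product_std_simplex_le:
  "volume_product (convex hull (range (std_vertex :: 'n option \<Rightarrow> real^'n)))
    \<le> (real CARD('n) + 1) ^ (CARD('n) + 1) / (fact CARD('n::finite))\<^sup>2"
proof -
  let ?N = "real CARD('n) + 1"
  let ?T = "convex hull (range (std_vertex :: 'n option \<Rightarrow> real^'n))"
  let ?u = "\<lambda>k. ?N *\<^sub>R facet_normal k :: real^'n"
  have N: "?N > 0" by (simp add: add_pos_nonneg)
  have "volume_product ?T \<le> measure lebesgue ?T * measure lebesgue (polar_body ?T centroid)"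
    unfolding volume_product_def
    by (rule cINF_lower[OF _ centroid_in_interior]) (auto intro!: bdd_belowI2[of _ 0])
  also have "\<dots> \<le> measure lebesgue ?T * hull_volume ?u"
  proof (rule mult_left_mono)
    show "measure lebesgue (polar_body ?T centroid) \<le> hull_volume ?u"
      unfolding hull_volume_def
    proof (rule measure_mono_fmeasurable)
      show "polar_body ?T centroid \<in> sets lebesgue"
        using lmeasurable_polar_body[OF centroid_in_interior] by blast
      show "polar_body ?T centroid \<subseteq> convex hull (range ?u)"
      proof
        fix y assume y: "y \<in> polar_body ?T centroid"
        define t where "t k = (1 - y \<bullet> (std_vertex k - centroid)) / ?N" for k
        have "0 \<le> t k" for k
        proof -
          have "std_vertex k \<in> ?T" by (simp add: hull_inc)
          then have "y \<bullet> (std_vertex k - centroid) \<le> 1" using y unfolding polar_body_def by blast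
          then show ?thesis using N by (simp add: t_def)
        qed
        moreover have "(\<Sum>k\<in>UNIV. t k) = 1"
        proof -
          have "(\<Sum>k\<in>UNIV. y \<bullet> (std_vertex k - centroid)) = 0"
            by (simp only: inner_sum_right[symmetric] sum_std_vertex_minus_centroid inner_zero_right)
          then have "(\<Sum>k\<in>UNIV. 1 - y \<bullet> (std_vertex k - centroid)) = ?N"
            by (simp only: sum_subtractf sum_constant card_UNIV_option_real) simp
          then show ?thesis
            unfolding t_def sum_divide_distrib[symmetric] using N by simp
        qed
        moreover have "y = (\<Sum>k\<in>UNIV. t k *\<^sub>R ?u k)"
        proof -
          have "(\<Sum>k\<in>UNIV. t k *\<^sub>R ?u k) = (\<Sum>k\<in>UNIV. facet_normal k - (y \<bullet> (std_vertex k - centroid)) *\<^sub>R facet_normal k)"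
            using N by (intro sum.cong) (simp_all add: t_def scaleR_diff_left)
          also have "\<dots> = - (\<Sum>k\<in>UNIV. (y \<bullet> (std_vertex k - centroid)) *\<^sub>R facet_normal k)"
            by (simp add: sum_subtractf sum_facet_normal)
          also have "\<dots> = y"
          proof -
            have yv: "y \<bullet> std_vertex (Some i) = y $ i" "y \<bullet> std_vertex None = 0" for i
              by (simp_all add: std_vertex_def inner_axis)
            show ?thesis
              by (simp add: sum_UNIV_option vec_eq_iff facet_normal_def axis_def inner_diff_right yv
                  if_distrib[of "\<lambda>y. _ * y"] sum_negf if_distrib[of uminus] cong: if_cong)
          qed
          finally show ?thesis by simp
        qed
        ultimately show "y \<in> convex hull (range ?u)"
          unfolding convex_hull_range[of ?u] by blast
      qed
    qed simp
  qed simp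
  also have "\<dots> = (real CARD('n) + 1) ^ (CARD('n) + 1) / (fact CARD('n))\<^sup>2"
    using hull_volume_std_vertex[where 'n='n] hull_volume_scaled_facet_normal[where 'n='n]
    by (simp add: hull_volume_def power2_eq_square)
  finally show ?thesis .
qed

section \<open>Inscribed simplices of maximal volume and the Banach-Mazur distance\<close>

text \<open>Compactness, for families of vertices viewed as points of \<open>(real^'n)^('n option)\<close>.\<close>
lemma exists_maximal_simplex:
  fixes K :: "(real^'n::finite) set"
  assumes K: "compact K" and ne: "interior K \<noteq> {}"
  shows "\<exists>P. range P \<subseteq> K \<and> 0 < hull_volume P \<and> (\<forall>Q. range Q \<subseteq> K \<longrightarrow> hull_volume Q \<le> hull_volume P)"
proof -
  define F where "F = {P :: (real^'n)^('n option). \<forall>k. P $ k \<in> K}"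
  define V where "V P = hull_volume (\<lambda>k. P $ k)" for P :: "(real^'n)^('n option)"
  have "closed F"
    unfolding F_def using K by (intro closed_vector_box) (simp add: compact_imp_closed)
  moreover have "bounded F"
  proof -
    obtain B where B: "\<And>x. x \<in> K \<Longrightarrow> norm x \<le> B"
      using compact_imp_bounded[OF K] unfolding bounded_iff by blast
    show ?thesis
      unfolding bounded_iff
    proof (intro exI ballI)
      fix P assume "P \<in> F"
      have "norm P \<le> (\<Sum>k\<in>UNIV. norm (P $ k))"
        unfolding norm_vec_def by (rule L2_set_le_sum) simp
      also have "\<dots> \<le> (\<Sum>k\<in>(UNIV :: 'n option set). B)"
        using \<open>P \<in> F\<close> B by (intro sum_mono) (auto simp: F_def)
      finally show "norm P \<le> (\<Sum>k\<in>(UNIV :: 'n option set). B)" .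
    qed
  qed
  ultimately have "compact F" by (simp add: compact_eq_bounded_closed)
  obtain p where p: "p \<in> interior K" using ne by blast
  obtain r where r: "0 < r" "cball p r \<subseteq> K"
    using p by (meson mem_interior_cball)
  define P0 :: "'n option \<Rightarrow> real^'n" where "P0 = (\<lambda>k. p + r *\<^sub>R std_vertex k)"
  have P0K: "P0 k \<in> K" for k
  proof -
    have "norm (std_vertex k) \<le> 1" by (cases k) (simp_all add: std_vertex_def)
    then have "P0 k \<in> cball p r" using r(1) by (simp add: P0_def dist_norm)
    then show ?thesis using r(2) by blast
  qed
  have "(\<chi> i. P0 (Some i) - P0 None) = (\<chi> i j. if i = j then r else 0)"
    by (auto simp: P0_def std_vertex_def vec_eq_iff axis_def)
  then have "det (\<chi> i. P0 (Some i) - P0 None) = (\<Prod>i\<in>(UNIV :: 'n set). r)"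
    by (simp add: det_diagonal)
  then have V0: "0 < hull_volume P0"
    using r unfolding hull_volume_det by simp
  have "continuous_on F V"
    unfolding V_def hull_volume_det det_def
    by (intro continuous_intros) (simp_all add: continuous_on_component)
  moreover have "F \<noteq> {}"
    using P0K by (auto simp: F_def intro!: exI[of _ "\<chi> k. P0 k"])
  ultimately obtain P where P: "P \<in> F" "\<And>Q. Q \<in> F \<Longrightarrow> V Q \<le> V P"
    using continuous_attains_sup[OF \<open>compact F\<close>, of V] by blast
  have max: "hull_volume Q \<le> hull_volume (\<lambda>k. P $ k)" if "range Q \<subseteq> K" for Q
    using P(2)[of "\<chi> k. Q k"] that by (auto simp: F_def V_def)
  show ?thesis
  proof (intro exI conjI allI impI)
    show "range (\<lambda>k. P $ k) \<subseteq> K" using P(1) by (auto simp: F_def)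
    show "0 < hull_volume (\<lambda>k. P $ k)"
      using max[of P0] P0K V0 by fastforce
  qed (rule max)
qed

lemma normalized_position:
  fixes K :: "(real^'n::finite) set"
  assumes "convex_body K"
  shows "\<exists>A K'. affine_isomorphism A \<and> K = A ` K' \<and> convex_body K' \<and> range std_vertex \<subseteq> K' \<and>
    (\<forall>P. range P \<subseteq> K' \<longrightarrow> hull_volume P \<le> 1 / fact CARD('n))"
proof -
  have K: "compact K" "convex K" "interior K \<noteq> {}"
    using assms by (auto simp: convex_body_def)
  obtain P where P: "range P \<subseteq> K" "0 < hull_volume P"
    and max: "\<And>Q. range Q \<subseteq> K \<Longrightarrow> hull_volume Q \<le> hull_volume P"
    using exists_maximal_simplex[OF K(1,3)] by blast
  define A where "A = simplex_map P"
  have A: "affine_isomorphism A"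
    unfolding A_def using P(2) by (intro affine_isomorphism_simplex_map) simp
  note bij = affine_isomorphism_bij[OF A]
  obtain d where d0: "0 < d" and "\<And>X. X \<in> lmeasurable \<Longrightarrow> A ` X \<in> lmeasurable"
    and d: "\<And>X. X \<in> lmeasurable \<Longrightarrow> measure lebesgue (A ` X) = d * measure lebesgue X"
    using affine_isomorphism_measure[OF A] by blast
  have Av: "A (std_vertex k) = P k" for k
    by (simp add: A_def simplex_map_def bary_std_vertex of_bool_def if_distrib[of "\<lambda>y. y *\<^sub>R _"] cong: if_cong)
  have VP: "hull_volume P = d / fact CARD('n)"
    using hull_volume_affine_image[OF d A, of std_vertex] by (simp add: Av hull_volume_std_vertex)
  define K' where "K' = inv A ` K"
  have KA: "K = A ` K'"
    unfolding K'_def using bij by (simp add: image_image bij_is_surj surj_f_inv_f)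
  have mem: "A x \<in> K \<Longrightarrow> x \<in> K'" for x
    unfolding K'_def using bij by (metis bij_is_inj image_eqI inv_f_f)
  obtain g c where g: "linear g" "inv A = (\<lambda>x. g x + c)"
    using affine_isomorphism_inv[OF A] unfolding affine_isomorphism_def by blast
  have K': "K' = (+) c ` g ` K" unfolding K'_def g(2) image_image by (simp add: add.commute)
  show ?thesis
  proof (intro exI conjI allI impI)
    show "affine_isomorphism A" "K = A ` K'" by fact+
    have "compact (g ` K)"
      using g(1) K(1) by (intro compact_continuous_image linear_continuous_on) (simp_all add: linear_conv_bounded_linear)
    then have "compact K'" "convex K'"
      unfolding K' using g(1) K(2) by (simp_all add: compact_translation convex_translation convex_linear_image)
    moreover have "interior K' \<noteq> {}"
      using K(3) unfolding KA affine_isomorphism_interior[OF A] by blast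
    ultimately show "convex_body K'" by (simp add: convex_body_def)
    show "range std_vertex \<subseteq> K'"
      using P(1) Av by (auto intro!: mem)
    fix Q :: "'n option \<Rightarrow> real^'n" assume Q: "range Q \<subseteq> K'"
    have "d * hull_volume Q = hull_volume (\<lambda>k. A (Q k))"
      using hull_volume_affine_image[OF d A] by simp
    also have "\<dots> \<le> d / fact CARD('n)"
      unfolding VP[symmetric] using Q KA by (intro max) auto
    finally show "hull_volume Q \<le> 1 / fact CARD('n)"
      using d0 by (simp add: field_simps)
  qed
qed

lemma hull_volume_replace_std_vertex:
  "hull_volume (std_vertex(k := x)) = \<bar>bary k x\<bar> / fact CARD('n)" for x :: "real^'n::finite"
proof -
  have "x = (\<Sum>j\<in>UNIV. bary j x *\<^sub>R std_vertex j)"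
    using simplex_map_std_vertex[of x] by (simp add: simplex_map_def)
  then show ?thesis
    using hull_volume_replace[of "\<lambda>j. bary j x" x std_vertex k] by (simp add: hull_volume_std_vertex)
qed

text \<open>A point with negative coordinate \<open>bary j\<close> spans with the facet opposite to \<open>j\<close> a simplex
  of volume \<open>\<bar>bary j x\<bar> / n!\<close> that meets the standard simplex in a null set only.\<close>
lemma bary_ge_if_measure_le:
  fixes K :: "(real^'n::finite) set"
  assumes K: "convex K" "range std_vertex \<subseteq> K" "K \<in> lmeasurable"
    and vol: "measure lebesgue K \<le> (1 + \<sigma>) / fact CARD('n)" "0 \<le> \<sigma>" and x: "x \<in> K"
  shows "- \<sigma> \<le> bary j x"
proof (cases "bary j x < 0")
  case True
  define P where "P b = (if b then std_vertex else std_vertex(j := x))" for b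
  have P: "convex hull (range (P b)) \<in> lmeasurable" for b by simp
  have facet_normal0: "facet_normal j \<noteq> 0"
  proof
    assume "facet_normal j = 0"
    moreover obtain i where "i \<noteq> j" by (cases j) auto
    ultimately show False using facet_normal_inner_std_vertex[of j j i] by simp
  qed
  have hyp: "negligible {y. bary j y = 0}"
  proof -
    have "{y. bary j y = 0} = {y. facet_normal j \<bullet> y = bary j 0}"
    proof -
      have "facet_normal j \<bullet> y = bary j 0 - bary j y" for y using facet_normal_inner[of j y 0] by simp
      then show ?thesis by auto
    qed
    then show ?thesis using facet_normal0 by (simp add: negligible_hyperplane)
  qed
  have neg: "negligible (convex hull (range (P True)) \<inter> convex hull (range (P False)))"
  proof (rule negligible_subset[OF hyp], clarify)
    fix y assume y: "y \<in> convex hull (range (P True))" "y \<in> convex hull (range (P False))"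
    have "0 \<le> bary j y" using y(1) unfolding P_def by (simp add: std_simplex_eq)
    moreover have "bary j y \<le> 0"
    proof -
      obtain t where t: "\<forall>k. 0 \<le> t k" "(\<Sum>k\<in>UNIV. t k) = 1" "y = (\<Sum>k\<in>UNIV. t k *\<^sub>R (std_vertex(j := x)) k)"
        using y(2) unfolding P_def convex_hull_range by auto
      have "bary j y = (\<Sum>k\<in>UNIV. t k * bary j ((std_vertex(j := x)) k))"
        unfolding t(3) by (rule bary_affine[OF t(2)])
      also have "\<dots> \<le> 0"
        using t(1) True by (intro sum_nonpos) (auto simp: bary_std_vertex mult_nonneg_nonpos)
      finally show ?thesis .
    qed
    ultimately show "bary j y = 0" by simp
  qed
  have "measure lebesgue (\<Union>b\<in>UNIV. convex hull (range (P b))) = (\<Sum>b\<in>UNIV. measure lebesgue (convex hull (range (P b))))"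
  proof (rule measure_negligible_finite_Union_image)
    show "pairwise (\<lambda>a b. negligible (convex hull (range (P a)) \<inter> convex hull (range (P b)))) UNIV"
      using neg by (auto simp: pairwise_def Int_commute) (metis (full_types) Int_commute)
  qed (simp_all add: P)
  also have "\<dots> = 1 / fact CARD('n) + \<bar>bary j x\<bar> / fact CARD('n)"
    using hull_volume_std_vertex[where 'n='n] hull_volume_replace_std_vertex[of j x]
    by (simp add: UNIV_bool P_def hull_volume_def)
  finally have "(1 - bary j x) / fact CARD('n) = measure lebesgue (\<Union>b\<in>UNIV. convex hull (range (P b)))"
    using True by (simp add: add_divide_distrib diff_divide_distrib)
  also have "\<dots> \<le> measure lebesgue K"
  proof (rule measure_mono_fmeasurable[OF _ _ K(3)])
    have "range (P b) \<subseteq> K" for b using K(2) x by (auto simp: P_def)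
    then show "(\<Union>b\<in>UNIV. convex hull (range (P b))) \<subseteq> K"
      using K(1) by (intro UN_least hull_minimal)
    show "(\<Union>b\<in>UNIV. convex hull (range (P b))) \<in> sets lebesgue"
      by (intro sets.finite_UN fmeasurableD P) simp
  qed
  finally have "(1 - bary j x) / fact CARD('n) \<le> (1 + \<sigma>) / fact CARD('n)" using vol by simp
  then show ?thesis by (simp add: divide_le_cancel)
qed (use vol in simp)

definition bm_ratio :: "'a::euclidean_space set \<Rightarrow> 'a set \<Rightarrow> real \<Rightarrow> bool" where
  "bm_ratio K L c \<longleftrightarrow> c > 0 \<and> (\<exists>A B. affine_isomorphism A \<and> affine_isomorphism B \<and>
                A ` L \<subseteq> B ` K \<and> B ` K \<subseteq> (\<lambda>x. c *\<^sub>R x) ` (A ` L))"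

lemma banach_mazur_distance_bm_ratio: "banach_mazur_distance K L = Inf {c. bm_ratio K L c}"
  by (simp add: banach_mazur_distance_def bm_ratio_def)

text \<open>The points with coordinates at least \<open>- t\<close> form the dilate of the standard simplex about its
  centroid by the factor \<open>1 + N * t\<close>.\<close>
lemma bm_ratio_if_bary_ge:
  fixes K' :: "(real^'n::finite) set"
  assumes A: "affine_isomorphism A" and B: "affine_isomorphism B"
    and K': "range std_vertex \<subseteq> K'" "convex K'" and t: "0 \<le> t" "\<And>k x. x \<in> K' \<Longrightarrow> - t \<le> bary k x"
  shows "bm_ratio (B ` K') (A ` (convex hull (range std_vertex))) (1 + (real CARD('n) + 1) * t)"
proof -
  let ?N = "real CARD('n) + 1"
  let ?T = "convex hull (range (std_vertex :: 'n option \<Rightarrow> real^'n))"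
  define c where "c = 1 + ?N * t"
  have N: "?N > 0" by (simp add: add_pos_nonneg)
  have c: "1 \<le> c" using t N by (simp add: c_def)
  define A' where "A' = (\<lambda>x. inv A x - centroid)"
  define B' where "B' = (\<lambda>x. inv B x - centroid)"
  have iso: "affine_isomorphism A'" "affine_isomorphism B'"
    unfolding A'_def B'_def
    using affine_isomorphism_comp[OF affine_isomorphism_translation affine_isomorphism_inv] A B by blast+
  have imA: "A' ` A ` ?T = (\<lambda>x. x - centroid) ` ?T"
    using affine_isomorphism_bij[OF A] by (simp add: A'_def image_image bij_is_inj)
  have imB: "B' ` B ` K' = (\<lambda>x. x - centroid) ` K'"
    using affine_isomorphism_bij[OF B] by (simp add: B'_def image_image bij_is_inj)
  have "?T \<subseteq> K'" using K' by (simp add: hull_minimal)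
  then have 1: "A' ` A ` ?T \<subseteq> B' ` B ` K'" unfolding imA imB by blast
  have 2: "B' ` B ` K' \<subseteq> (\<lambda>x. c *\<^sub>R x) ` (A' ` A ` ?T)"
    unfolding imA imB
  proof clarify
    fix x assume x: "x \<in> K'"
    define q where "q = (1 / c) *\<^sub>R x + (1 - 1 / c) *\<^sub>R centroid"
    have "0 \<le> bary k q" for k
    proof -
      have "bary k q = 1 / c * bary k x + (1 - 1 / c) * (1 / ?N)"
        unfolding q_def by (subst bary_combine) (simp_all add: bary_centroid)
      also have "\<dots> = (bary k x + (c - 1) / ?N) / c"
      proof -
        have "1 - 1 / c = (c - 1) / c" using c by (simp add: field_simps)
        then show ?thesis by (simp add: add_divide_distrib)
      qed
      also have "(c - 1) / ?N = t" using N by (simp add: c_def)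
      finally show ?thesis using t(2)[OF x, of k] c by simp
    qed
    then have "q \<in> ?T" by (simp add: std_simplex_eq)
    moreover have "x - centroid = c *\<^sub>R (q - centroid)"
      using c by (simp add: q_def algebra_simps)
    ultimately show "x - centroid \<in> (\<lambda>x. c *\<^sub>R x) ` (\<lambda>x. x - centroid) ` ?T" by blast
  qed
  show ?thesis
    unfolding bm_ratio_def c_def[symmetric] using c iso 1 2 by (intro conjI exI[of _ A'] exI[of _ B']) auto
qed

lemma bdd_below_bm_ratio: "bdd_below {c. bm_ratio K L c}"
  by (rule bdd_belowI[of _ 0]) (auto simp: bm_ratio_def)

lemma measure_scaleR_image:
  fixes X :: "(real^'n) set"
  assumes "X \<in> lmeasurable"
  shows "(\<lambda>x. c *\<^sub>R x) ` X \<in> lmeasurable" "measure lebesgue ((\<lambda>x. c *\<^sub>R x) ` X) = \<bar>c\<bar> ^ CARD('n) * measure lebesgue X"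
proof -
  have eq: "(\<lambda>x::real^'n. c *\<^sub>R x) = (\<lambda>x. \<chi> k. c * x $ k)" by (simp add: fun_eq_iff vec_eq_iff)
  show "(\<lambda>x. c *\<^sub>R x) ` X \<in> lmeasurable" "measure lebesgue ((\<lambda>x. c *\<^sub>R x) ` X) = \<bar>c\<bar> ^ CARD('n) * measure lebesgue X"
    unfolding eq using measurable_stretch[OF assms, of "\<lambda>_. c"] measure_stretch[OF assms, of "\<lambda>_. c"]
    by (simp_all add: power_abs)
qed

text \<open>The inner copy of the simplex in \<open>K'\<close> is no larger than the inscribed simplex of maximal volume, and
  the outer copy is \<open>c ^ n\<close> times as large.\<close>
lemma measure_le_if_bm_ratio:
  fixes K' :: "(real^'n::finite) set"
  assumes A: "affine_isomorphism A" and B: "affine_isomorphism B" and K': "K' \<in> lmeasurable"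
    and max: "\<And>P. range P \<subseteq> K' \<Longrightarrow> hull_volume P \<le> 1 / fact CARD('n)"
    and c: "bm_ratio (B ` K') (A ` (convex hull (range std_vertex))) c"
  shows "measure lebesgue K' \<le> c ^ CARD('n) / fact CARD('n)"
proof -
  let ?T = "convex hull (range (std_vertex :: 'n option \<Rightarrow> real^'n))"
  obtain A1 B1 where c0: "0 < c" and iso: "affine_isomorphism A1" "affine_isomorphism B1"
    and sub: "A1 ` A ` ?T \<subseteq> B1 ` B ` K'" "B1 ` B ` K' \<subseteq> (\<lambda>x. c *\<^sub>R x) ` (A1 ` A ` ?T)"
    using c unfolding bm_ratio_def by blast
  define F where "F = (\<lambda>x. A1 (A x))"
  define G where "G = (\<lambda>x. B1 (B x))"
  have F: "affine_isomorphism F" and G: "affine_isomorphism G"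
    unfolding F_def G_def using iso A B by (simp_all add: affine_isomorphism_comp)
  have im: "A1 ` A ` ?T = F ` ?T" "B1 ` B ` K' = G ` K'" by (simp_all add: F_def G_def image_image)
  obtain f where f: "0 < f" "\<And>X. X \<in> lmeasurable \<Longrightarrow> F ` X \<in> lmeasurable"
    "\<And>X. X \<in> lmeasurable \<Longrightarrow> measure lebesgue (F ` X) = f * measure lebesgue X"
    using affine_isomorphism_measure[OF F] by blast
  obtain g where g: "0 < g" "\<And>X. X \<in> lmeasurable \<Longrightarrow> G ` X \<in> lmeasurable"
    "\<And>X. X \<in> lmeasurable \<Longrightarrow> measure lebesgue (G ` X) = g * measure lebesgue X"
    using affine_isomorphism_measure[OF G] by blast
  define P where "P = (\<lambda>k. inv G (F (std_vertex k)))"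
  have GP: "G (P k) = F (std_vertex k)" for k
    using affine_isomorphism_bij[OF G] by (simp add: P_def bij_is_surj surj_f_inv_f)
  have "g * hull_volume P = hull_volume (\<lambda>k. F (std_vertex k))"
    using hull_volume_affine_image[OF g(3) G, of P] by (simp add: GP)
  also have "\<dots> = f / fact CARD('n)"
    using hull_volume_affine_image[OF f(3) F, of std_vertex] by (simp add: hull_volume_std_vertex)
  finally have "f / fact CARD('n) = g * hull_volume P" ..
  also have "\<dots> \<le> g * (1 / fact CARD('n))"
  proof (intro mult_left_mono max)
    show "range P \<subseteq> K'"
    proof clarify
      fix k
      have "F (std_vertex k) \<in> G ` K'" using sub(1) unfolding im by (meson hull_inc image_eqI rangeI subsetD)
      then have "G (P k) \<in> G ` K'" by (simp add: GP)
      then show "P k \<in> K'" using affine_isomorphism_bij[OF G] by (simp add: bij_is_inj inj_image_mem_iff)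
    qed
  qed (use g in simp)
  finally have fg: "f \<le> g" by (simp add: divide_le_cancel)
  have "g * measure lebesgue K' = measure lebesgue (G ` K')" using g(3)[OF K'] by simp
  also have "\<dots> \<le> measure lebesgue ((\<lambda>x. c *\<^sub>R x) ` F ` ?T)"
    using sub(2) unfolding im
    by (intro measure_mono_fmeasurable measure_scaleR_image f fmeasurableD g K') auto
  also have "\<dots> = c ^ CARD('n) * (f * (1 / fact CARD('n)))"
    using measure_scaleR_image(2)[OF f(2), of ?T c] f(3)[of ?T] c0 hull_volume_std_vertex[where 'n='n]
    by (simp add: hull_volume_def)
  also have "\<dots> \<le> c ^ CARD('n) * (g * (1 / fact CARD('n)))"
    using fg c0 by (intro mult_left_mono mult_right_mono) auto
  finally show ?thesis using g(1) by (simp add: field_simps)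
qed

section \<open>Local minimality of the simplex\<close>

lemma sum_offdiag_swap:
  "(\<Sum>i\<in>UNIV. \<Sum>j\<in>UNIV - {i}. f j i) = (\<Sum>i\<in>UNIV. \<Sum>j\<in>UNIV - {i}. f i j)"
  for f :: "'k::finite \<Rightarrow> 'k \<Rightarrow> real"
proof -
  have "(\<Sum>j\<in>UNIV - {i}. f j i) = (\<Sum>j\<in>UNIV. f j i) - f i i" "(\<Sum>j\<in>UNIV - {i}. f i j) = (\<Sum>j\<in>UNIV. f i j) - f i i" for i
    by (simp_all add: sum_diff1)
  then show ?thesis
    by (simp add: sum_subtractf) (rule sum.swap)
qed

lemma continuous_on_vertex_functional: "continuous_on X (vertex_functional \<epsilon> i j)"
  unfolding vertex_functional_def[abs_def] by (intro continuous_intros continuous_on_bary)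

text \<open>By compactness the vertex functionals attain their maxima on \<open>K\<close>. The same excesses \<open>S i j\<close> then
  enter both expansions, which therefore hold with one and the same \<open>Q\<close>.\<close>
lemma volume_bounds_inscribed:
  fixes K :: "(real^'n::finite) set"
  defines "n \<equiv> real CARD('n)" and "N \<equiv> real CARD('n) + 1"
  assumes K: "convex_body K" "range std_vertex \<subseteq> K"
    and b1: "\<And>k x. x \<in> K \<Longrightarrow> bary k x \<le> 1" and b\<tau>: "\<And>k x. x \<in> K \<Longrightarrow> - \<tau> \<le> bary k x"
    and \<epsilon>: "0 < \<epsilon>" "4 * n * \<epsilon> \<le> 1" and \<tau>: "(n / \<epsilon> + n + 2) * \<tau> \<le> \<epsilon> / n"
    and y: "y \<in> K" "bary m y = - t" "0 \<le> t" "t \<le> 1"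
  obtains Q where "0 \<le> Q" "Q \<le> 2 * n * N * \<tau>"
    "1 + Q + t / (6 * N) - 2 * n * N\<^sup>2 * \<tau>\<^sup>2 - 2 * n\<^sup>2 * N * \<epsilon> * \<tau> \<le> fact CARD('n) * measure lebesgue K"
    "\<And>z. z \<in> interior K \<Longrightarrow> N ^ (CARD('n) + 1) / fact CARD('n) * (1 - Q - n\<^sup>2 * N * \<epsilon> * \<tau>) \<le> measure lebesgue (polar_body K z)"
proof -
  have n1: "1 \<le> n" unfolding n_def by (simp add: Suc_leI)
  have N: "N = n + 1" "N \<ge> 2" using n1 by (simp_all add: N_def n_def)
  have comp: "compact K" and conv: "convex K" and bdd: "bounded K"
    using K(1) by (auto simp: convex_body_def compact_imp_bounded)
  have \<epsilon>': "\<epsilon> \<le> 1 / 4" "\<epsilon> < 1"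
  proof -
    have "1 * \<epsilon> \<le> n * \<epsilon>" using n1 \<epsilon> by (intro mult_right_mono) auto
    then show "\<epsilon> \<le> 1 / 4" using \<epsilon>(2) unfolding mult.assoc by linarith
    then show "\<epsilon> < 1" by simp
  qed
  have "\<exists>x. x \<in> K \<and> (\<forall>x'\<in>K. vertex_functional \<epsilon> i j x' \<le> vertex_functional \<epsilon> i j x)" for i j
    using continuous_attains_sup[OF comp _ continuous_on_vertex_functional[of K \<epsilon> i j]] y(1) by blast
  then obtain x where x: "\<And>i j. x i j \<in> K"
    "\<And>i j x'. x' \<in> K \<Longrightarrow> vertex_functional \<epsilon> i j x' \<le> vertex_functional \<epsilon> i j (x i j)"
    by metis
  define S where "S i j = vertex_functional \<epsilon> i j (x i j) - \<epsilon> / n" for i j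
  have S0: "0 \<le> S i j" if "i \<noteq> j" for i j
  proof -
    have "vertex_functional \<epsilon> i j (std_vertex i) \<le> vertex_functional \<epsilon> i j (x i j)"
      using K(2) by (intro x(2)) blast
    then show ?thesis using that by (simp add: S_def vertex_functional_def bary_std_vertex n_def)
  qed
  have S1: "S i j \<le> \<tau>" if "i \<noteq> j" for i j
  proof -
    have "\<epsilon> / n * bary i (x i j) \<le> \<epsilon> / n * 1"
      using b1[OF x(1)] \<epsilon> n1 by (intro mult_left_mono) auto
    moreover have "- ((1 - \<epsilon>) * bary j (x i j)) \<le> \<tau>"
    proof (cases "bary j (x i j) \<ge> 0")
      case True
      have "0 \<le> \<tau>"
      proof -
        have "- \<tau> \<le> bary j (std_vertex i)" using K(2) by (intro b\<tau>) blast
        then show ?thesis using that by (simp add: bary_std_vertex)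
      qed
      moreover have "0 \<le> (1 - \<epsilon>) * bary j (x i j)" using True \<epsilon>' by simp
      ultimately show ?thesis by linarith
    next
      case False
      then have "(1 - \<epsilon>) * (- bary j (x i j)) \<le> 1 * (- bary j (x i j))"
        using \<epsilon> by (intro mult_right_mono) auto
      then show ?thesis using b\<tau>[OF x(1), of j i j] by simp
    qed
    ultimately show ?thesis by (simp add: S_def vertex_functional_def n_def)
  qed
  have \<tau>0: "0 \<le> \<tau>" using S0[of None "Some undefined"] S1[of None "Some undefined"] by simp
  define Q where "Q = (n - 1) / (n * (1 - \<epsilon>)) * (\<Sum>i\<in>UNIV. \<Sum>j\<in>UNIV - {i}. S i j)"
  have \<Sigma>: "0 \<le> (\<Sum>i\<in>UNIV. \<Sum>j\<in>UNIV - {i}. S i j)" "(\<Sum>i\<in>UNIV. \<Sum>j\<in>UNIV - {i}. S i j) \<le> N * (n * \<tau>)"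
  proof -
    show "0 \<le> (\<Sum>i\<in>UNIV. \<Sum>j\<in>UNIV - {i}. S i j)" using S0 by (intro sum_nonneg) auto
    have "(\<Sum>i\<in>UNIV. \<Sum>j\<in>UNIV - {i}. S i j) \<le> (\<Sum>i\<in>(UNIV :: 'n option set). \<Sum>j\<in>UNIV - {i}. \<tau>)"
      using S1 by (intro sum_mono) auto
    also have "\<dots> = (\<Sum>i\<in>(UNIV :: 'n option set). n * \<tau>)"
      by (intro sum.cong) (simp_all add: n_def card_Diff_subset)
    also have "\<dots> = N * (n * \<tau>)"
      by (simp only: sum_constant card_UNIV_option_real N_def)
    finally show "(\<Sum>i\<in>UNIV. \<Sum>j\<in>UNIV - {i}. S i j) \<le> N * (n * \<tau>)" .
  qed
  have coeff: "0 \<le> (n - 1) / (n * (1 - \<epsilon>))" "(n - 1) / (n * (1 - \<epsilon>)) \<le> 2"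
  proof -
    show "0 \<le> (n - 1) / (n * (1 - \<epsilon>))" using n1 \<epsilon>' by simp
    have "n * (1 / 2) \<le> n * (1 - \<epsilon>)" using n1 \<epsilon>' by (intro mult_left_mono) auto
    then have "n - 1 \<le> 2 * (n * (1 - \<epsilon>))" by simp
    then show "(n - 1) / (n * (1 - \<epsilon>)) \<le> 2" using n1 \<epsilon>' by (simp add: divide_le_eq)
  qed
  show thesis
  proof
    show "0 \<le> Q" unfolding Q_def by (rule mult_nonneg_nonneg[OF coeff(1) \<Sigma>(1)])
    have "Q \<le> 2 * (N * (n * \<tau>))"
      unfolding Q_def using coeff \<Sigma> by (intro mult_mono) auto
    then show "Q \<le> 2 * n * N * \<tau>" by (simp add: mult_ac)
    have "vertex_functional \<epsilon> i j (x i j) = \<epsilon> / real CARD('n) + S i j" for i j by (simp add: S_def n_def)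
    then show "1 + Q + t / (6 * N) - 2 * n * N\<^sup>2 * \<tau>\<^sup>2 - 2 * n\<^sup>2 * N * \<epsilon> * \<tau> \<le> fact CARD('n) * measure lebesgue K"
      using measure_ge_inscribed[OF conv bdd K(2) b1 b\<tau> \<epsilon>[unfolded n_def] \<tau>[unfolded n_def], of S x y m t]
        S0 S1 x(1) y
      unfolding Q_def sum_offdiag_swap[of S] n_def N_def by blast
    fix z assume "z \<in> interior K"
    then show "N ^ (CARD('n) + 1) / fact CARD('n) * (1 - Q - n\<^sup>2 * N * \<epsilon> * \<tau>) \<le> measure lebesgue (polar_body K z)"
      using measure_polar_ge_inscribed[of z K \<tau> \<epsilon> S] b1 b\<tau> \<epsilon> \<epsilon>' \<tau>0 S0 x(2)
      unfolding Q_def n_def N_def S_def by simp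
  qed
qed

text \<open>In \<open>(1 + Q + a) * (1 - Q - b)\<close> the term \<open>Q\<close> cancels to first order in \<open>\<delta>\<close>.\<close>
lemma product_gain:
  fixes Q q w a b \<delta> X Y :: real
  assumes \<delta>: "0 < \<delta>" and Q: "0 \<le> Q" "Q \<le> q * \<delta>" and a: "0 \<le> a" "a \<le> \<delta>" and b: "0 \<le> b" "b \<le> \<delta>" and w: "0 \<le> w"
    and X: "1 + Q + a - w * \<delta>\<^sup>2 \<le> X" and Y: "1 - Q - b \<le> Y"
    and small: "(q + 1) * \<delta> \<le> 1 / 2" "w * \<delta>\<^sup>2 \<le> 1"
  shows "1 + (a - b) - (w + (q + 1)\<^sup>2) * \<delta>\<^sup>2 \<le> X * Y"
proof -
  define e where "e = a - w * \<delta>\<^sup>2"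
  have e: "e \<le> \<delta>" "- 1 \<le> e" using a w small by (auto simp: e_def) (smt (verit) zero_le_mult_iff zero_le_power2)
  have Qb: "Q + b \<le> (q + 1) * \<delta>" using Q b by (simp add: algebra_simps)
  have "(Q + e) * (Q + b) \<le> (Q + \<delta>) * (Q + b)" using e Q b by (intro mult_right_mono) auto
  also have "\<dots> \<le> ((q + 1) * \<delta>) * ((q + 1) * \<delta>)"
    using Q b \<delta> Qb by (intro mult_mono) (auto simp: algebra_simps)
  also have "\<dots> = (q + 1)\<^sup>2 * \<delta>\<^sup>2" by (simp add: power2_eq_square)
  finally have *: "(Q + e) * (Q + b) \<le> (q + 1)\<^sup>2 * \<delta>\<^sup>2" .
  have "1 + (a - b) - (w + (q + 1)\<^sup>2) * \<delta>\<^sup>2 = 1 + e - b - (q + 1)\<^sup>2 * \<delta>\<^sup>2"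
    by (simp add: e_def algebra_simps)
  also have "\<dots> \<le> 1 + e - b - (Q + e) * (Q + b)" using * by simp
  also have "\<dots> = (1 + Q + e) * (1 - Q - b)" by (simp add: algebra_simps)
  also have "\<dots> \<le> X * Y"
    using X Y Q e Qb small by (intro mult_mono) (auto simp: e_def)
  finally show ?thesis .
qed

lemma one_plus_power_le:
  assumes "0 \<le> x" "real n * x \<le> 1"
  shows "(1 + x) ^ n \<le> 1 + 2 * real n * x"
proof -
  have "(1 + x) ^ n \<le> exp x ^ n" using assms by (intro power_mono) auto
  also have "\<dots> = exp (real n * x)" by (simp add: exp_of_nat_mult)
  also have "\<dots> \<le> 1 + real n * x + (real n * x)\<^sup>2" using assms by (intro exp_bound) auto
  also have "(real n * x)\<^sup>2 \<le> real n * x" using assms by (simp add: power2_eq_square mult_left_le)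
  finally show ?thesis by (simp add: algebra_simps)
qed

theorem theorem1:
  shows "\<exists>\<delta>\<^sub>0>0. \<exists>C>0. \<forall>(S :: (real ^ 'n) set) K \<delta>.
           int CARD('n) simplex S \<longrightarrow> convex_body K \<longrightarrow> 0 < \<delta> \<longrightarrow> \<delta> < \<delta>\<^sub>0 \<longrightarrow>
           banach_mazur_distance K S = 1 + \<delta> \<longrightarrow>
           volume_product K \<ge> volume_product S + C * \<delta>"
proof -
  define n where "n = real CARD('n)"
  define N where "N = n + 1"
  \<comment> \<open>chosen so that the errors of order \<open>\<epsilon> * \<delta>\<close> amount to a quarter of the gain \<open>\<delta> / (12 * N\<^sup>2)\<close>\<close>
  define \<epsilon> where "\<epsilon> = 1 / (576 * n ^ 3 * N ^ 3)"
  define q where "q = 8 * n\<^sup>2 * N"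
  define w where "w = 32 * n ^ 3 * N\<^sup>2"
  define W where "W = w + (q + 1)\<^sup>2"
  define p where "p = N ^ (CARD('n) + 1) / (fact CARD('n))\<^sup>2"
  \<comment> \<open>the four bounds give in this order \<open>\<tau> \<le> 1\<close>, maximizers near the vertices, \<open>Q\<close> small, and quadratic errors below half of the remaining gain \<open>\<delta> / (16 * N\<^sup>2)\<close>\<close>
  define \<delta>\<^sub>0 where "\<delta>\<^sub>0 = Min {1 / (4 * n), \<epsilon> / n / ((n / \<epsilon> + n + 2) * (4 * n)), 1 / (2 * (q + 1)), 1 / (32 * N\<^sup>2 * W)}"
  have n1: "1 \<le> n" unfolding n_def by (simp add: Suc_leI)
  have N2: "2 \<le> N" using n1 by (simp add: N_def)
  have q: "0 \<le> q" using n1 N2 by (simp add: q_def)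
  have w: "0 \<le> w" using n1 N2 by (simp add: w_def)
  have W: "1 \<le> W" "w \<le> W" using w q by (simp_all add: W_def power2_eq_square algebra_simps)
  have \<epsilon>0: "0 < \<epsilon>" using n1 N2 by (simp add: \<epsilon>_def)
  have p: "0 < p" using N2 by (simp add: p_def)
  have \<delta>0: "0 < \<delta>\<^sub>0" unfolding \<delta>\<^sub>0_def using n1 N2 \<epsilon>0 q W by (simp add: add_pos_nonneg)
  have \<epsilon>n: "4 * n * \<epsilon> \<le> 1"
  proof -
    have "4 * n \<le> 576 * (n * (n * n * N ^ 3))"
    proof -
      have "1 \<le> n * n * N ^ 3"
        using n1 N2 by (metis (no_types, opaque_lifting) mult_ge1_I one_le_numeral one_le_power order_trans)
      then have "n * 1 \<le> n * (n * n * N ^ 3)" using n1 by (intro mult_left_mono) auto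
      then show ?thesis using n1 by linarith
    qed
    then show ?thesis using n1 N2 by (simp add: \<epsilon>_def divide_le_eq power3_eq_cube mult_ac)
  qed
  have main: "volume_product S + p / (32 * N\<^sup>2) * \<delta> \<le> volume_product K"
    if S: "int CARD('n) simplex S" and K: "convex_body K" and \<delta>: "0 < \<delta>" "\<delta> < \<delta>\<^sub>0"
      and dist: "banach_mazur_distance K S = 1 + \<delta>" for S K :: "(real^'n) set" and \<delta>
  proof -
    have \<delta>1: "4 * n * \<delta> \<le> 1" and \<delta>2: "(n / \<epsilon> + n + 2) * (4 * n * \<delta>) \<le> \<epsilon> / n"
      and \<delta>3: "(q + 1) * \<delta> \<le> 1 / 2" and \<delta>4: "W * \<delta> \<le> 1 / (32 * N\<^sup>2)"
    proof -
      have "\<delta> \<le> 1 / (4 * n)" using \<delta> by (simp add: \<delta>\<^sub>0_def)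
      then show "4 * n * \<delta> \<le> 1" using n1 by (simp add: field_simps)
      have le: "\<delta> \<le> \<epsilon> / n / ((n / \<epsilon> + n + 2) * (4 * n))" using \<delta> by (simp add: \<delta>\<^sub>0_def)
      have pos: "0 < (n / \<epsilon> + n + 2) * (4 * n)" using n1 \<epsilon>0 by (intro mult_pos_pos add_pos_pos) auto
      have "\<delta> * ((n / \<epsilon> + n + 2) * (4 * n)) \<le> \<epsilon> / n"
        using le unfolding pos_le_divide_eq[OF pos] .
      then show "(n / \<epsilon> + n + 2) * (4 * n * \<delta>) \<le> \<epsilon> / n" by (simp add: mult_ac)
      have le: "\<delta> \<le> 1 / (2 * (q + 1))" using \<delta> by (simp add: \<delta>\<^sub>0_def)
      have pos: "0 < 2 * (q + 1)" using q by simp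
      have "\<delta> * (2 * (q + 1)) \<le> 1"
        using le unfolding pos_le_divide_eq[OF pos] .
      then show "(q + 1) * \<delta> \<le> 1 / 2" by (simp add: algebra_simps)
      have "\<delta> \<le> 1 / (32 * N\<^sup>2 * W)" using \<delta> by (simp add: \<delta>\<^sub>0_def)
      then have le: "\<delta> \<le> 1 / (32 * N\<^sup>2) / W" by simp
      have pos: "0 < W" using W by simp
      show "W * \<delta> \<le> 1 / (32 * N\<^sup>2)"
        using le unfolding pos_le_divide_eq[OF pos] by (simp only: mult.commute)
    qed
    obtain A where A: "affine_isomorphism A" "S = A ` (convex hull (range std_vertex))"
      using simplex_is_affine_image[OF S] by blast
    obtain B K' where B: "affine_isomorphism B" "K = B ` K'" and K': "convex_body K'" "range std_vertex \<subseteq> K'"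
      and max: "\<And>P. range P \<subseteq> K' \<Longrightarrow> hull_volume P \<le> 1 / fact CARD('n)"
      using normalized_position[OF K] by blast
    have conv: "convex K'" and meas: "K' \<in> lmeasurable"
      using K'(1) by (auto simp: convex_body_def lmeasurable_compact)
    have b1: "\<bar>bary k x\<bar> \<le> 1" if "x \<in> K'" for k x
    proof -
      have "range (std_vertex(k := x)) \<subseteq> K'" using K'(2) that by auto
      from max[OF this] show ?thesis by (simp add: hull_volume_replace_std_vertex divide_le_cancel)
    qed
    have ratio: "bm_ratio K S (1 + N * s)" if "0 \<le> s" "\<And>k x. x \<in> K' \<Longrightarrow> - s \<le> bary k x" for s
      using bm_ratio_if_bary_ge[OF A(1) B(1) K'(2) conv that] unfolding A(2) B(2) N_def n_def by blast
    have "{c. bm_ratio K S c} \<noteq> {}"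
    proof -
      have "- 1 \<le> bary k x" if "x \<in> K'" for k x using b1[OF that, of k] by simp
      then have "bm_ratio K S (1 + N * 1)" by (intro ratio) auto
      then show ?thesis by blast
    qed
    moreover have "Inf {c. bm_ratio K S c} < 1 + 2 * \<delta>"
      using dist \<delta> by (simp add: banach_mazur_distance_bm_ratio)
    ultimately obtain c where c: "bm_ratio K S c" "c < 1 + 2 * \<delta>"
      using cInf_lessD[of "{c. bm_ratio K S c}" "1 + 2 * \<delta>"] by blast
    have "measure lebesgue K' \<le> c ^ CARD('n) / fact CARD('n)"
      using measure_le_if_bm_ratio[OF A(1) B(1) meas max] c(1) unfolding A(2) B(2) by blast
    also have "\<dots> \<le> (1 + 4 * n * \<delta>) / fact CARD('n)"
    proof (rule divide_right_mono)
      have "c ^ CARD('n) \<le> (1 + 2 * \<delta>) ^ CARD('n)"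
        using c by (intro power_mono) (auto simp: bm_ratio_def)
      also have "\<dots> \<le> 1 + 2 * n * (2 * \<delta>)"
        unfolding n_def
      proof (rule one_plus_power_le)
        have "0 \<le> n * \<delta>" using n1 \<delta> by simp
        then show "real CARD('n) * (2 * \<delta>) \<le> 1" using \<delta>1 by (simp add: n_def)
      qed (use \<delta> in simp)
      finally show "c ^ CARD('n) \<le> 1 + 4 * n * \<delta>" by simp
    qed simp
    finally have vol: "measure lebesgue K' \<le> (1 + 4 * n * \<delta>) / fact CARD('n)" .
    define \<tau> where "\<tau> = 4 * n * \<delta>"
    have \<tau>0: "0 \<le> \<tau>" "\<tau> \<le> 1" using n1 \<delta> \<delta>1 by (simp_all add: \<tau>_def)
    have b\<tau>: "- \<tau> \<le> bary k x" if "x \<in> K'" for k x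
      using bary_ge_if_measure_le[OF conv K'(2) meas vol[folded \<tau>_def] \<tau>0(1) that] .
    have "\<exists>y\<in>K'. \<exists>m. bary m y < - (\<delta> / (2 * N))"
    proof (rule ccontr)
      assume "\<not> ?thesis"
      then have "bm_ratio K S (1 + N * (\<delta> / (2 * N)))"
        using \<delta> N2 by (intro ratio) (auto simp: not_less)
      then have "banach_mazur_distance K S \<le> 1 + N * (\<delta> / (2 * N))"
        unfolding banach_mazur_distance_bm_ratio by (intro cInf_lower bdd_below_bm_ratio) simp
      then show False using dist \<delta> N2 by simp
    qed
    then obtain y m where y: "y \<in> K'" "bary m y < - (\<delta> / (2 * N))" by blast
    define t where "t = - bary m y"
    have t: "\<delta> / (2 * N) \<le> t" "t \<le> 1" "bary m y = - t"
      using y b1[OF y(1), of m] by (auto simp: t_def)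
    have t0: "0 \<le> t" using t(1) \<delta> N2 by (meson divide_nonneg_nonneg less_imp_le order_trans mult_nonneg_nonneg zero_le_numeral)
    obtain Q where Q: "0 \<le> Q" "Q \<le> 2 * n * N * \<tau>"
      and vK: "1 + Q + t / (6 * N) - 2 * n * N\<^sup>2 * \<tau>\<^sup>2 - 2 * n\<^sup>2 * N * \<epsilon> * \<tau> \<le> fact CARD('n) * measure lebesgue K'"
      and vP: "\<And>z. z \<in> interior K' \<Longrightarrow> N ^ (CARD('n) + 1) / fact CARD('n) * (1 - Q - n\<^sup>2 * N * \<epsilon> * \<tau>) \<le> measure lebesgue (polar_body K' z)"
      using volume_bounds_inscribed[OF K', of \<tau> \<epsilon> y m t] b1 b\<tau> \<epsilon>0 \<epsilon>n \<delta>2 y(1) t t0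
      unfolding n_def[symmetric] N_def[symmetric] \<tau>_def[symmetric] by (metis abs_le_D1)
    have "p * (1 + \<delta> / (32 * N\<^sup>2)) \<le> measure lebesgue K' * measure lebesgue (polar_body K' z)" if z: "z \<in> interior K'" for z
    proof -
      define X where "X = fact CARD('n) * measure lebesgue K'"
      define Y where "Y = 1 - Q - n\<^sup>2 * N * \<epsilon> * \<tau>"
      have err: "n\<^sup>2 * N * \<epsilon> * \<tau> = \<delta> / (144 * N\<^sup>2)"
        using n1 N2 by (simp add: \<epsilon>_def \<tau>_def power2_eq_square power3_eq_cube)
      have "\<delta> / (12 * N\<^sup>2) \<le> t / (6 * N)"
      proof -
        have "\<delta> / (12 * N\<^sup>2) = \<delta> / (2 * N) / (6 * N)" by (simp add: power2_eq_square)
        also have "\<dots> \<le> t / (6 * N)" using t N2 by (intro divide_right_mono) auto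
        finally show ?thesis .
      qed
      moreover have "2 * n * N\<^sup>2 * \<tau>\<^sup>2 = w * \<delta>\<^sup>2" by (simp add: \<tau>_def w_def power2_eq_square power3_eq_cube)
      moreover have "2 * n\<^sup>2 * N * \<epsilon> * \<tau> = 2 * (\<delta> / (144 * N\<^sup>2))" using err by simp
      ultimately have X: "1 + Q + (\<delta> / (12 * N\<^sup>2) - 2 * (\<delta> / (144 * N\<^sup>2))) - w * \<delta>\<^sup>2 \<le> X"
        using vK unfolding X_def by linarith
      define s where "s = \<delta> / N\<^sup>2"
      have s: "0 \<le> s" "s \<le> \<delta>"
      proof -
        show "0 \<le> s" using \<delta> by (simp add: s_def)
        have "1 \<le> N\<^sup>2" using N2 by simp
        then have "\<delta> * 1 \<le> \<delta> * N\<^sup>2" using \<delta> by (intro mult_left_mono) auto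
        then show "s \<le> \<delta>" using N2 by (simp add: s_def divide_le_eq)
      qed
      have s': "\<delta> / (12 * N\<^sup>2) = s / 12" "\<delta> / (144 * N\<^sup>2) = s / 144" "\<delta> / (32 * N\<^sup>2) = s / 32" by (simp_all add: s_def)
      have \<delta>4': "W * \<delta>\<^sup>2 \<le> s / 32"
      proof -
        have "(W * \<delta>) * \<delta> \<le> (1 / (32 * N\<^sup>2)) * \<delta>" using \<delta>4 \<delta> by (intro mult_right_mono) auto
        then show ?thesis using s'(3) by (simp add: power2_eq_square mult.assoc)
      qed
      have "1 + ((s / 12 - 2 * (s / 144)) - s / 144) - (w + (q + 1)\<^sup>2) * \<delta>\<^sup>2 \<le> X * Y"
      proof (rule product_gain[where Q = Q])
        show "Q \<le> q * \<delta>" using Q(2) by (simp add: q_def \<tau>_def power2_eq_square mult_ac)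
        show "1 + Q + (s / 12 - 2 * (s / 144)) - w * \<delta>\<^sup>2 \<le> X" using X unfolding s' .
        show "1 - Q - s / 144 \<le> Y" unfolding Y_def err s' by simp
        have "w * \<delta>\<^sup>2 \<le> W * \<delta>\<^sup>2" using W by (intro mult_right_mono) auto
        moreover have "\<delta> \<le> 1"
        proof -
          have "1 * \<delta> \<le> (4 * n) * \<delta>" using n1 \<delta> by (intro mult_right_mono) auto
          then show ?thesis using \<delta>1 by simp
        qed
        ultimately show "w * \<delta>\<^sup>2 \<le> 1" using \<delta>4' s by linarith
      qed (use \<delta> Q s w \<delta>3 in auto)
      then have XY: "1 + s / 32 \<le> X * Y"
        using \<delta>4' by (simp add: W_def)
      have "p * (1 + s / 32) \<le> p * (X * Y)" using XY p by (intro mult_left_mono) auto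
      also have "\<dots> = measure lebesgue K' * (N ^ (CARD('n) + 1) / fact CARD('n) * Y)"
        by (simp add: p_def X_def power2_eq_square)
      also have "\<dots> \<le> measure lebesgue K' * measure lebesgue (polar_body K' z)"
        using vP[OF z] unfolding Y_def by (intro mult_left_mono) auto
      finally show ?thesis unfolding s' .
    qed
    then have "p * (1 + \<delta> / (32 * N\<^sup>2)) \<le> volume_product K'"
      unfolding volume_product_def using K'(1) by (intro cINF_greatest) (auto simp: convex_body_def)
    also have "\<dots> = volume_product K"
      unfolding B(2) by (rule volume_product_affine_image[OF B(1) meas, symmetric])
    finally have "p + p / (32 * N\<^sup>2) * \<delta> \<le> volume_product K" by (simp add: distrib_left)
    moreover have "volume_product S \<le> p"
      using volume_product_affine_image[OF A(1), of "convex hull (range std_vertex)"] volume_product_std_simplex_le[where 'n='n]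
      by (simp add: A(2) p_def N_def n_def)
    ultimately show ?thesis by simp
  qed
  have "0 < p / (32 * N\<^sup>2)" using p N2 by simp
  then have "\<exists>C>0. \<forall>(S :: (real ^ 'n) set) K \<delta>.
           int CARD('n) simplex S \<longrightarrow> convex_body K \<longrightarrow> 0 < \<delta> \<longrightarrow> \<delta> < \<delta>\<^sub>0 \<longrightarrow>
           banach_mazur_distance K S = 1 + \<delta> \<longrightarrow>
           volume_product K \<ge> volume_product S + C * \<delta>"
    using main by (intro exI[of _ "p / (32 * N\<^sup>2)"]) auto
  with \<delta>0 show ?thesis by blast
qed

end
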